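(* Let $d\ge 1$ and let $\mathcal S\subset\{-1,0,1\}^d$ be a step-set with positive weights $w(s)>0$, $s\in\mathcal S$, such that $\mathcal S$ is not contained in any closed half-space $\{y\in\mathbb R^d:\langle u,y\rangle\ge0\}$ with $u\in\mathbb R^d\setminus\{0\}$. Let $G$ be the combinatorial group of the model and $H$ the reflection group associated with it (both defined in the context). If $G$ is finite, then $G$ is isomorphic to $H$.
   Context: The inventory is $\chi_\mathcal S(x_1,\dots,x_d)=\sum_{(i_1,\dots,i_d)\in\mathcal S}w(i_1,\dots,i_d)x_1^{i_1}\cdots x_d^{i_d}$. For each $j$ write $\chi_\mathcal S=x_jA_j+B_j+\overline{x_j}C_j$ with $A_j,B_j,C_j$ Laurent polynomials in the variables other than $x_j$, and $\overline{x_j}=1/x_j$ (under the hypothesis, $A_j,C_j\neq0$). The group $G=\langle\varphi_1,\dots,\varphi_d\rangle$ is the group of birational transformations of $[x_1,\dots,x_d]$ generated by the involutions $\varphi_j$, which replace $x_j$ by $\overline{x_j}\,C_j/A_j$ and leave the other coordinates unchanged. The system $\partial\chi_\mathcal S/\partial x_1=\dots=\partial\chi_\mathcal S/\partial x_d=0$ has a unique solution $\boldsymbol{x_0}\in(0,\infty)^d$. Let $\Delta=(a_{ij})_{1\le i,j\le d}$ with $a_{ij}=\frac{\partial^2\chi_\mathcal S}{\partial x_i\partial x_j}(\boldsymbol{x_0})\big/\sqrt{\frac{\partial^2\chi_\mathcal S}{\partial x_i^2}(\boldsymbol{x_0})\frac{\partial^2\chi_\mathcal S}{\partial x_j^2}(\boldsymbol{x_0})}$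 (a symmetric positive definite matrix), and let $\Delta^{-1/2}$ be the inverse of its positive definite square root. Let $T=\Delta^{-1/2}\mathbb R_+^d$, bounded by the hyperplanes $H_i=\Delta^{-1/2}G_i$, where $G_i=\mathrm{Span}\{e_k:k\neq i\}$ and $(e_k)$ is the canonical basis. Then $H=\langle r_1,\dots,r_d\rangle$, where $r_i$ is the orthogonal reflection in the hyperplane $H_i$. *)

theory Defs
  imports
    "HOL-Analysis.Analysis"
    "HOL-Library.Poly_Mapping"
    "HOL-Computational_Algebra.Fraction_Field"
    "HOL-Algebra.Elementary_Groups"
    "HOL-Algebra.Bij"
begin

section \<open>Rational functions and birational transformations\<close>

text \<open>
  The coordinates are indexed by a finite linearly ordered type \<open>'n\<close>, in the role of
  \<open>{1, \<dots>, d}\<close>; the order is what the library needs to see that polynomials form a domain.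
\<close>

type_synonym 'n mpoly = "('n \<Rightarrow>\<^sub>0 nat) \<Rightarrow>\<^sub>0 real"
type_synonym 'n ratfun = "'n mpoly fract"

definition const_rf :: "real \<Rightarrow> ('n::{finite,linorder}) ratfun" where
  "const_rf c = Fract (Poly_Mapping.single 0 c) 1"

definition var_rf :: "'n \<Rightarrow> ('n::{finite,linorder}) ratfun" where
  "var_rf i = Fract (Poly_Mapping.single (Poly_Mapping.single i 1) 1) 1"

definition mpoly_eval :: "(real \<Rightarrow> 'a::field) \<Rightarrow> ('n::finite \<Rightarrow> 'a) \<Rightarrow> 'n mpoly \<Rightarrow> 'a" where
  "mpoly_eval c x p =
     (\<Sum>m\<in>Poly_Mapping.keys p. c (Poly_Mapping.lookup p m) * (\<Prod>i\<in>UNIV. x i ^ Poly_Mapping.lookup m i))"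

text \<open>
  Substitution of a tuple \<open>f\<close> of rational functions for the variables of \<open>r\<close>. It is meaningful
  when \<open>r\<close> can be written with a denominator that does not vanish identically along \<open>f\<close>; the
  value does not depend on the choice of such a fraction. For dominant \<open>f\<close> (below) this is the case
  for every \<open>r\<close>.
\<close>

definition subst_rf :: "('n::{finite,linorder} \<Rightarrow> 'n ratfun) \<Rightarrow> 'n ratfun \<Rightarrow> 'n ratfun" where
  "subst_rf f r =
     (THE y. \<exists>p q. q \<noteq> 0 \<and> r = Fract p q \<and> mpoly_eval const_rf f q \<noteq> 0 \<and>
        y = mpoly_eval const_rf f p / mpoly_eval const_rf f q)"

text \<open>
  A tuple \<open>f\<close> stands for the rational map sending \<open>[x\<^sub>1, \<dots>, x\<^sub>d]\<close> to \<open>[f\<^sub>1(x), \<dots>, f\<^sub>d(x)]\<close>.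
\<close>

definition dominant :: "('n::{finite,linorder} \<Rightarrow> 'n ratfun) \<Rightarrow> bool" where
  "dominant f \<longleftrightarrow> (\<forall>p. p \<noteq> 0 \<longrightarrow> mpoly_eval const_rf f p \<noteq> 0)"

definition rat_comp ::
    "('n::{finite,linorder} \<Rightarrow> 'n ratfun) \<Rightarrow> ('n \<Rightarrow> 'n ratfun) \<Rightarrow> 'n \<Rightarrow> 'n ratfun" where
  "rat_comp f g = (\<lambda>i. subst_rf g (f i))"

definition birational :: "('n::{finite,linorder} \<Rightarrow> 'n ratfun) \<Rightarrow> bool" where
  "birational f \<longleftrightarrow>
     dominant f \<and> (\<exists>g. dominant g \<and> rat_comp f g = var_rf \<and> rat_comp g f = var_rf)"

definition birational_group :: "('n::{finite,linorder} \<Rightarrow> 'n ratfun) monoid" where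
  "birational_group = \<lparr>carrier = {f. birational f}, mult = rat_comp, one = var_rf\<rparr>"


section \<open>The inventory and the combinatorial group\<close>

text \<open>
  The inventory and its coefficients are defined over an arbitrary field receiving the weights via
  \<open>c\<close>: rational functions for the combinatorial group, the reals for the analytic part.
  The Laurent polynomial \<open>inv_coeff c S w j e\<close> is the coefficient of \<open>x\<^sub>j\<close> to the power \<open>e\<close>, so that
  \<open>A\<^sub>j\<close>, \<open>B\<^sub>j\<close>, \<open>C\<^sub>j\<close> are the cases \<open>e = 1, 0, -1\<close>.
\<close>

definition inventory ::
    "(real \<Rightarrow> 'a::field) \<Rightarrow> (int ^ 'n::finite) set \<Rightarrow> (int ^ 'n \<Rightarrow> real) \<Rightarrow> ('n \<Rightarrow> 'a) \<Rightarrow> 'a" where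
  "inventory c S w x = (\<Sum>s\<in>S. c (w s) * (\<Prod>k\<in>UNIV. x k powi (s $ k)))"

definition inv_coeff ::
    "(real \<Rightarrow> 'a::field) \<Rightarrow> (int ^ 'n::finite) set \<Rightarrow> (int ^ 'n \<Rightarrow> real) \<Rightarrow> 'n \<Rightarrow> int \<Rightarrow> ('n \<Rightarrow> 'a) \<Rightarrow> 'a" where
  "inv_coeff c S w j e x = (\<Sum>s\<in>{s\<in>S. s $ j = e}. c (w s) * (\<Prod>k\<in>UNIV - {j}. x k powi (s $ k)))"

lemma inventory_decomp:
  fixes S :: "(int ^ 'n) set"
  assumes "S \<subseteq> {s. \<forall>i. s $ i \<in> {-1, 0, 1}}"
  shows "inventory c S w x =
    x j * inv_coeff c S w j 1 x + inv_coeff c S w j 0 x + inverse (x j) * inv_coeff c S w j (-1) x"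
proof -
  have "{s :: int ^ 'n. \<forall>i. s $ i \<in> {-1, 0, 1}} \<subseteq> vec_lambda ` (UNIV \<rightarrow>\<^sub>E {-1, 0, 1})"
  proof
    fix s :: "int ^ 'n"
    assume "s \<in> {s. \<forall>i. s $ i \<in> {-1, 0, 1}}"
    then have "vec_nth s \<in> UNIV \<rightarrow>\<^sub>E {-1, 0, 1}"
      by (simp add: PiE_def Pi_def)
    then show "s \<in> vec_lambda ` (UNIV \<rightarrow>\<^sub>E {-1, 0, 1})"
      by (metis image_eqI vec_nth_inverse)
  qed
  moreover have "finite (vec_lambda ` ((UNIV :: 'n set) \<rightarrow>\<^sub>E {-1, 0, 1 :: int}))"
    by (intro finite_imageI finite_PiE) auto
  ultimately have fin: "finite S"
    by (rule finite_subset[OF subset_trans[OF assms]])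
  define F where "F s = c (w s) * (\<Prod>k\<in>UNIV. x k powi (s $ k))" for s
  define P where "P e = {s \<in> S. s $ j = e}" for e
  have split: "F s = x j powi e * (c (w s) * (\<Prod>k\<in>UNIV - {j}. x k powi (s $ k)))"
    if "s \<in> P e" for s e
    using that by (simp add: F_def P_def prod.remove[OF finite UNIV_I, of _ j])
  have part: "sum F (P e) = x j powi e * inv_coeff c S w j e x" for e
    unfolding inv_coeff_def P_def[symmetric] sum_distrib_left
    by (rule sum.cong) (simp_all add: split)
  have S: "S = P 1 \<union> P 0 \<union> P (-1)"
    using assms by (auto simp: P_def)
  have disj: "P 1 \<inter> P 0 = {}" "(P 1 \<union> P 0) \<inter> P (-1) = {}"
    by (auto simp: P_def)
  have finP: "finite (P e)" for e
    using fin by (simp add: P_def)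
  have "sum F S = sum F (P 1) + sum F (P 0) + sum F (P (-1))"
    by (subst S) (simp add: sum.union_disjoint finP disj)
  then show ?thesis
    unfolding part by (simp add: inventory_def F_def power_int_minus)
qed

definition phi ::
    "(int ^ 'n::{finite,linorder}) set \<Rightarrow> (int ^ 'n::{finite,linorder} \<Rightarrow> real) \<Rightarrow> 'n \<Rightarrow> 'n \<Rightarrow> 'n ratfun" where
  "phi S w j =
     var_rf(j := inverse (var_rf j) *
                 (inv_coeff const_rf S w j (-1) var_rf / inv_coeff const_rf S w j 1 var_rf))"

definition comb_group ::
    "(int ^ 'n::{finite,linorder}) set \<Rightarrow> (int ^ 'n::{finite,linorder} \<Rightarrow> real) \<Rightarrow> ('n \<Rightarrow> 'n ratfun) monoid" where
  "comb_group S w = subgroup_generated birational_group (range (phi S w))"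


section \<open>The reflection group\<close>

definition partial_deriv :: "'n \<Rightarrow> (real ^ 'n::finite \<Rightarrow> real) \<Rightarrow> real ^ 'n \<Rightarrow> real" where
  "partial_deriv i f x = deriv (\<lambda>t. f (\<chi> k. if k = i then t else x $ k)) (x $ i)"

definition real_inventory ::
    "(int ^ 'n::finite) set \<Rightarrow> (int ^ 'n \<Rightarrow> real) \<Rightarrow> real ^ 'n \<Rightarrow> real" where
  "real_inventory S w x = inventory (\<lambda>a. a) S w (\<lambda>k. x $ k)"

definition crit_point :: "(int ^ 'n::finite) set \<Rightarrow> (int ^ 'n \<Rightarrow> real) \<Rightarrow> real ^ 'n" where
  "crit_point S w =
     (THE x. (\<forall>i. x $ i > 0) \<and> (\<forall>i. partial_deriv i (real_inventory S w) x = 0))"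

definition hess :: "(int ^ 'n::finite) set \<Rightarrow> (int ^ 'n \<Rightarrow> real) \<Rightarrow> 'n \<Rightarrow> 'n \<Rightarrow> real" where
  "hess S w i j = partial_deriv i (partial_deriv j (real_inventory S w)) (crit_point S w)"

definition Delta :: "(int ^ 'n::finite) set \<Rightarrow> (int ^ 'n \<Rightarrow> real) \<Rightarrow> real ^ 'n ^ 'n" where
  "Delta S w = (\<chi> i j. hess S w i j / sqrt (hess S w i i * hess S w j j))"

definition pos_def_matrix :: "real ^ 'n ^ 'n::finite \<Rightarrow> bool" where
  "pos_def_matrix A \<longleftrightarrow> transpose A = A \<and> (\<forall>v. v \<noteq> 0 \<longrightarrow> v \<bullet> (A *v v) > 0)"

definition matrix_sqrt :: "real ^ 'n ^ 'n::finite \<Rightarrow> real ^ 'n ^ 'n" where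
  "matrix_sqrt A = (THE B. pos_def_matrix B \<and> B ** B = A)"

definition wall :: "(int ^ 'n::finite) set \<Rightarrow> (int ^ 'n \<Rightarrow> real) \<Rightarrow> 'n \<Rightarrow> (real ^ 'n) set" where
  "wall S w i = (\<lambda>v. matrix_inv (matrix_sqrt (Delta S w)) *v v) ` span {axis k 1 |k. k \<noteq> i}"

definition orth_reflection :: "'a::euclidean_space set \<Rightarrow> 'a \<Rightarrow> 'a" where
  "orth_reflection W =
     (THE r. linear r \<and> (\<forall>v\<in>W. r v = v) \<and> (\<forall>v\<in>W\<^sup>\<bottom>. r v = - v))"

definition refl_group ::
    "(int ^ 'n::finite) set \<Rightarrow> (int ^ 'n \<Rightarrow> real) \<Rightarrow> (real ^ 'n \<Rightarrow> real ^ 'n) monoid" where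
  "refl_group S w =
     subgroup_generated (BijGroup UNIV) (range (\<lambda>i. orth_reflection (wall S w i)))"

definition step_vec :: "int ^ 'n::finite \<Rightarrow> real ^ 'n" where
  "step_vec s = (\<chi> i. of_int (s $ i))"

end

theory Submission
  imports Defs "HOL-Algebra.Multiplicative_Group"
begin

text \<open>
  Every generator \<open>\<phi>\<^sub>j\<close> of \<open>G\<close> fixes the critical point \<open>x\<^sub>0\<close>, and its derivative there is the reflection
  in \<open>e\<^sub>j\<close> for the bilinear form given by the Hessian of the inventory. Hence \<open>g \<mapsto> Dg(x\<^sub>0)\<close> is a linear
  representation of \<open>G\<close>, and rescaling the coordinates followed by \<open>\<Delta>\<^bsup>1/2\<^esup>\<close> turns these reflections into
  the orthogonal reflections \<open>r\<^sub>j\<close>, so that its image is conjugate to \<open>H\<close>. If \<open>G\<close> is finite, the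
  representation is faithful: for \<open>g\<close> of order dividing \<open>N\<close> with \<open>Dg(x\<^sub>0) = 1\<close>, the map
  \<open>\<psi> = g\<^sup>0 + \<dots> + g\<^bsup>N-1\<^esup>\<close> has derivative \<open>N\<close> at \<open>x\<^sub>0\<close>, so it is injective near \<open>x\<^sub>0\<close>, while
  \<open>\<psi> \<circ> g = \<psi>\<close>; thus \<open>g\<close> is the identity near \<open>x\<^sub>0\<close> and therefore as a rational map.
\<close>

section \<open>Substitution and the group of birational maps\<close>

text \<open>The obstacle is that elements of \<open>G\<close> are tuples of formal fractions
  composed by substitution, while the representation needs real functions. The relation
  \<open>germ\<close> is the bridge: a fraction with a denominator nonzero at \<open>x_0\<close>,
  together with a real function that agrees with it nearby. The generators are regular at
  \<open>x_0\<close> because \<open>A_j\<close> and \<open>C_j\<close> are sums of positive terms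
  there, and composites stay regular because \<open>x_0\<close> is fixed:
  \<open>A_j - C_j / x_j^2 = 0\<close> says precisely that \<open>x_j = C_j / (A_j x_j)\<close>.
  Conversely, identities valid near \<open>x_0\<close> are identities of rational functions, so even
  the involution law and the dominance of the generators are read off from real computations. The
  analytic facts come from logarithmic coordinates: there the inventory is a sum of exponentials,
  coercive and strictly convex by the half-space hypothesis, and its Hessian at \<open>x_0\<close>
  is the matrix of second moments \<open>m_ij = x_i x_j * hess_ij\<close>, which
  \<open>Delta\<close> normalizes to unit diagonal.\<close>

lemma sum_single_lookup:
  "(\<Sum>m\<in>Poly_Mapping.keys p. Poly_Mapping.single m (Poly_Mapping.lookup p m)) = p"
  by (rule poly_mapping_eqI) (simp add: lookup_sum lookup_single when_def in_keys_iff)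

text \<open>Evaluation is used for two coefficient maps, \<open>const_rf\<close> into rational
  functions and the identity of the reals; the locale proves its laws once for both.\<close>

locale scalar_hom =
  fixes c :: "real \<Rightarrow> 'a::field"
  assumes add: "c (a + b) = c a + c b"
    and mult: "c (a * b) = c a * c b"
    and one: "c 1 = 1"
begin

lemma zero: "c 0 = 0"
  by (metis add add_0 add_cancel_right_right)

lemma mpoly_eval_superset:
  assumes "finite K" "Poly_Mapping.keys p \<subseteq> K"
  shows "mpoly_eval c x p =
    (\<Sum>m\<in>K. c (Poly_Mapping.lookup p m) * (\<Prod>i\<in>UNIV. x i ^ Poly_Mapping.lookup m i))"
  unfolding mpoly_eval_def
  by (rule sum.mono_neutral_left) (use assms in \<open>auto simp: in_keys_iff zero\<close>)

lemma mpoly_eval_add: "mpoly_eval c x (p + q) = mpoly_eval c x p + mpoly_eval c x q"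
proof -
  let ?K = "Poly_Mapping.keys p \<union> Poly_Mapping.keys q"
  have "Poly_Mapping.keys (p + q) \<subseteq> ?K"
    by (rule Poly_Mapping.keys_add)
  then show ?thesis
    by (simp add: mpoly_eval_superset[of ?K] lookup_add add ring_distribs sum.distrib)
qed

lemma mpoly_eval_zero: "mpoly_eval c x 0 = 0"
  by (simp add: mpoly_eval_def)

lemma mpoly_eval_single:
  "mpoly_eval c x (Poly_Mapping.single m a) = c a * (\<Prod>i\<in>UNIV. x i ^ Poly_Mapping.lookup m i)"
  by (simp add: mpoly_eval_superset[of "{m}"])

lemma mpoly_eval_one: "mpoly_eval c x 1 = 1"
  by (simp flip: single_one add: mpoly_eval_single one)

lemma mpoly_eval_sum: "mpoly_eval c x (sum f A) = (\<Sum>a\<in>A. mpoly_eval c x (f a))"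
  by (induction A rule: infinite_finite_induct) (auto simp: mpoly_eval_zero mpoly_eval_add)

lemma mpoly_eval_mult: "mpoly_eval c x (p * q) = mpoly_eval c x p * mpoly_eval c x q"
proof -
  have "p * q = (\<Sum>m\<in>Poly_Mapping.keys p. \<Sum>n\<in>Poly_Mapping.keys q.
      Poly_Mapping.single (m + n) (Poly_Mapping.lookup p m * Poly_Mapping.lookup q n))"
    by (subst sum_single_lookup[of p, symmetric], subst sum_single_lookup[of q, symmetric]) (simp add: sum_product mult_single)
  then have "mpoly_eval c x (p * q) = (\<Sum>m\<in>Poly_Mapping.keys p. \<Sum>n\<in>Poly_Mapping.keys q.
      c (Poly_Mapping.lookup p m * Poly_Mapping.lookup q n) *
      (\<Prod>i\<in>UNIV. x i ^ Poly_Mapping.lookup (m + n) i))"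
    by (simp only: mpoly_eval_sum mpoly_eval_single)
  also have "\<dots> = mpoly_eval c x p * mpoly_eval c x q"
    by (simp add: mpoly_eval_def sum_product lookup_add power_add prod.distrib mult mult_ac)
  finally show ?thesis .
qed

lemma mpoly_eval_var:
  "mpoly_eval c x (Poly_Mapping.single (Poly_Mapping.single j 1) 1) = x j"
proof -
  have "(\<Prod>i\<in>UNIV. x i ^ Poly_Mapping.lookup (Poly_Mapping.single j 1) i) = x j ^ 1"
    by (subst prod.remove[of _ j]) (auto simp: lookup_single when_def)
  then show ?thesis by (simp only: mpoly_eval_single one) simp
qed

end

interpretation const_rf: scalar_hom "const_rf :: real \<Rightarrow> ('n::{finite,linorder}) ratfun"
  by unfold_locales (simp_all add: const_rf_def single_add mult_single fract_collapse)

text \<open>The embedding of polynomials into fractions commutes with sums, products and powers, so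
  a polynomial is rebuilt from its monomials. This makes \<open>var_rf\<close> dominant and a right
  unit for composition.\<close>

lemma mpoly_eval_var_rf: "mpoly_eval const_rf var_rf p = Fract p 1"
proof -
  have pow: "(Fract p 1 :: 'a ratfun) ^ k = Fract (p ^ k) 1" for p :: "'a mpoly" and k
    by (induction k) (simp_all add: fract_collapse)
  have prod: "(\<Prod>i\<in>A. Fract (f i) 1 :: 'a ratfun) = Fract (prod f A) 1"
    for f :: "'a \<Rightarrow> 'a mpoly" and A
    by (induction A rule: infinite_finite_induct) (auto simp: fract_collapse)
  have sum: "(\<Sum>i\<in>A. Fract (f i) 1 :: 'a ratfun) = Fract (sum f A) 1"
    for f :: "('a \<Rightarrow>\<^sub>0 nat) \<Rightarrow> 'a mpoly" and A
    by (induction A rule: infinite_finite_induct) (auto simp: fract_collapse)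
  have spow: "Poly_Mapping.single (Poly_Mapping.single i 1) 1 ^ k
      = Poly_Mapping.single (Poly_Mapping.single i k) (1::real)" for i :: 'a and k
  proof (induction k)
    case (Suc k)
    have "Poly_Mapping.single i (Suc k) = Poly_Mapping.single i 1 + Poly_Mapping.single i k"
      by (simp flip: single_add)
    then show ?case
      using Suc mult_single[of "Poly_Mapping.single i 1" "1::real" "Poly_Mapping.single i k" 1] by simp
  qed simp
  have sprod: "(\<Prod>i\<in>A. Poly_Mapping.single (m i) 1) = Poly_Mapping.single (\<Sum>i\<in>A. m i) (1::real)"
    for m :: "'a \<Rightarrow> 'a \<Rightarrow>\<^sub>0 nat" and A
    by (induction A rule: infinite_finite_induct) (auto simp: mult_single)
  have m: "(\<Sum>i\<in>UNIV. Poly_Mapping.single i (Poly_Mapping.lookup m i)) = m" for m :: "'a \<Rightarrow>\<^sub>0 nat"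
    by (rule poly_mapping_eqI) (simp add: lookup_sum lookup_single when_def)
  have mon: "(\<Prod>i\<in>UNIV. var_rf i ^ Poly_Mapping.lookup m i) =
      (Fract (Poly_Mapping.single m 1) 1 :: 'a ratfun)" for m
    by (simp only: var_rf_def pow prod spow sprod m)
  show ?thesis
    by (simp add: mpoly_eval_def mon const_rf_def mult_single sum sum_single_lookup)
qed

text \<open>Equal fractions have equal cross products, and evaluation is multiplicative. Only the
  one denominator \<open>q\<close> must survive along \<open>f\<close>, so the rule also applies to
  tuples whose dominance is not yet known.\<close>

lemma subst_rf_eqI:
  assumes q: "mpoly_eval const_rf f q \<noteq> 0"
  shows "subst_rf f (Fract p q) = mpoly_eval const_rf f p / mpoly_eval const_rf f q"
proof -
  let ?E = "mpoly_eval const_rf f"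
  have q0: "q \<noteq> 0" using q by (auto simp: const_rf.mpoly_eval_zero)
  show ?thesis
    unfolding subst_rf_def
  proof (rule the_equality)
    show "\<exists>p' q'. q' \<noteq> 0 \<and> Fract p q = Fract p' q' \<and> ?E q' \<noteq> 0 \<and> ?E p / ?E q = ?E p' / ?E q'"
      using q q0 by blast
  next
    fix y
    assume "\<exists>p' q'. q' \<noteq> 0 \<and> Fract p q = Fract p' q' \<and> ?E q' \<noteq> 0 \<and> y = ?E p' / ?E q'"
    then obtain p' q' where q': "q' \<noteq> 0" "?E q' \<noteq> 0" "y = ?E p' / ?E q'" and "Fract p q = Fract p' q'"
      by blast
    then have "p * q' = p' * q" using q0 by (simp add: eq_fract)
    then have "?E p * ?E q' = ?E p' * ?E q" by (metis const_rf.mpoly_eval_mult)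
    then show "y = ?E p / ?E q" using q q' by (simp add: frac_eq_eq)
  qed
qed

section \<open>Substitution of a dominant tuple as a field endomorphism\<close>

context
  fixes f :: "'n::{finite,linorder} \<Rightarrow> 'n ratfun"
  assumes dom: "dominant f"
begin

lemma subst_rf_Fract:
  "q \<noteq> 0 \<Longrightarrow> subst_rf f (Fract p q) = mpoly_eval const_rf f p / mpoly_eval const_rf f q"
  using dom by (intro subst_rf_eqI) (auto simp: dominant_def)

lemma mpoly_eval_dominant_nonzero: "q \<noteq> 0 \<Longrightarrow> mpoly_eval const_rf f q \<noteq> 0"
  using dom by (auto simp: dominant_def)

lemma subst_rf_add: "subst_rf f (r + s) = subst_rf f r + subst_rf f s"
  by (cases r; cases s)
    (simp add: subst_rf_Fract mpoly_eval_dominant_nonzero const_rf.mpoly_eval_add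
      const_rf.mpoly_eval_mult field_simps)

lemma subst_rf_mult: "subst_rf f (r * s) = subst_rf f r * subst_rf f s"
  by (cases r; cases s) (simp add: subst_rf_Fract const_rf.mpoly_eval_mult)

lemma subst_rf_poly: "subst_rf f (Fract p 1) = mpoly_eval const_rf f p"
  by (simp add: subst_rf_Fract const_rf.mpoly_eval_one)

lemma subst_rf_const: "subst_rf f (const_rf a) = const_rf a"
  by (simp add: const_rf_def[of a, where 'n='n] subst_rf_poly const_rf.mpoly_eval_single)

lemma subst_rf_var: "subst_rf f (var_rf i) = f i"
  by (simp only: var_rf_def subst_rf_poly const_rf.mpoly_eval_var)

lemma subst_rf_one: "subst_rf f 1 = 1"
  using subst_rf_const[of 1] by (simp add: const_rf.one)

lemma subst_rf_zero: "subst_rf f 0 = 0"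
  using subst_rf_const[of 0] by (simp add: const_rf.zero)

lemma subst_rf_divide: "subst_rf f (r / s) = subst_rf f r / subst_rf f s"
proof (cases "s = 0")
  case True
  then show ?thesis by (simp add: subst_rf_zero)
next
  case False
  then have "subst_rf f (r / s) * subst_rf f s = subst_rf f r" "subst_rf f (inverse s) * subst_rf f s = 1"
    by (simp_all flip: subst_rf_mult add: subst_rf_one)
  then show ?thesis
    by (metis eq_divide_imp mult_zero_right zero_neq_one)
qed

lemma subst_rf_power: "subst_rf f (r ^ k) = subst_rf f r ^ k"
  by (induction k) (auto simp: subst_rf_mult subst_rf_one)

lemma subst_rf_prod: "subst_rf f (prod h A) = (\<Prod>i\<in>A. subst_rf f (h i))"
  by (induction A rule: infinite_finite_induct) (auto simp: subst_rf_mult subst_rf_one)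

lemma subst_rf_sum: "subst_rf f (sum h A) = (\<Sum>i\<in>A. subst_rf f (h i))"
  by (induction A rule: infinite_finite_induct) (auto simp: subst_rf_add subst_rf_zero)

lemma subst_rf_mpoly_eval:
  "subst_rf f (mpoly_eval const_rf g p) = mpoly_eval const_rf (rat_comp g f) p"
  by (simp add: mpoly_eval_def subst_rf_sum subst_rf_mult subst_rf_const subst_rf_prod
      subst_rf_power rat_comp_def)

lemma subst_rf_nonzero: "r \<noteq> 0 \<Longrightarrow> subst_rf f r \<noteq> 0"
  by (metis right_inverse subst_rf_mult subst_rf_one mult_zero_left zero_neq_one)

lemma dominant_rat_comp: "dominant g \<Longrightarrow> dominant (rat_comp g f)"
  by (simp add: dominant_def[of g] dominant_def[of "rat_comp g f"] subst_rf_nonzero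
      flip: subst_rf_mpoly_eval)

text \<open>Substitution reverses the order of composition: pulling back along \<open>g\<close> and
  then along \<open>f\<close> is pulling back along the map that applies \<open>f\<close> first.
  Associativity of \<open>rat_comp\<close> is this law in each component.\<close>

lemma subst_rf_subst_rf:
  assumes "dominant g"
  shows "subst_rf f (subst_rf g r) = subst_rf (rat_comp g f) r"
proof (cases r)
  case (Fract p q)
  have *: "mpoly_eval const_rf (rat_comp g f) q \<noteq> 0" "mpoly_eval const_rf g q \<noteq> 0"
    using Fract dominant_rat_comp[OF assms] assms by (auto simp: dominant_def)
  then show ?thesis
    by (simp add: Fract subst_rf_eqI[OF *(1)] subst_rf_eqI[OF *(2)] subst_rf_divide
        subst_rf_mpoly_eval)
qed

lemma rat_comp_var_left: "rat_comp var_rf f = f"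
  by (simp add: rat_comp_def subst_rf_var)

end

lemma dominant_var_rf: "dominant var_rf"
  by (simp add: dominant_def mpoly_eval_var_rf Zero_fract_def eq_fract)

lemma rat_comp_var_right: "rat_comp f var_rf = f"
proof
  fix i
  show "rat_comp f var_rf i = f i"
    by (cases "f i") (simp add: rat_comp_def subst_rf_Fract[OF dominant_var_rf] mpoly_eval_var_rf)
qed

lemma rat_comp_assoc:
  assumes "dominant g" "dominant h"
  shows "rat_comp (rat_comp f g) h = rat_comp f (rat_comp g h)"
proof
  fix i
  have "rat_comp (rat_comp f g) h i = subst_rf h (subst_rf g (f i))"
    by (simp add: rat_comp_def)
  also have "\<dots> = rat_comp f (rat_comp g h) i"
    unfolding subst_rf_subst_rf[OF assms(2,1)] by (simp add: rat_comp_def[of f])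
  finally show "rat_comp (rat_comp f g) h i = rat_comp f (rat_comp g h) i" .
qed

lemma group_birational_group: "Group.group (birational_group :: ('n::{finite,linorder} \<Rightarrow> 'n ratfun) monoid)"
proof (rule groupI)
  fix f g :: "'n \<Rightarrow> 'n ratfun"
  assume "f \<in> carrier birational_group" "g \<in> carrier birational_group"
  then obtain f' g' where *: "dominant f" "dominant g" "dominant f'" "dominant g'"
    "rat_comp f f' = var_rf" "rat_comp f' f = var_rf"
    "rat_comp g g' = var_rf" "rat_comp g' g = var_rf"
    by (auto simp: birational_group_def birational_def)
  \<comment> \<open>The inverse of a product is the product of the inverses in reverse order; each
    reassociation needs dominance of the two right factors.\<close>
  have "rat_comp (rat_comp f g) (rat_comp g' f') = var_rf"
    by (metis * dominant_rat_comp rat_comp_assoc rat_comp_var_left)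
  moreover have "rat_comp (rat_comp g' f') (rat_comp f g) = var_rf"
    by (metis * dominant_rat_comp rat_comp_assoc rat_comp_var_left)
  ultimately show "f \<otimes>\<^bsub>birational_group\<^esub> g \<in> carrier birational_group"
    using * dominant_rat_comp by (auto simp: birational_group_def birational_def)
next
  show "\<one>\<^bsub>birational_group\<^esub> \<in> carrier birational_group"
    using dominant_var_rf by (auto simp: birational_group_def birational_def rat_comp_var_right)
qed (auto simp: birational_group_def birational_def rat_comp_assoc rat_comp_var_left)

section \<open>Polynomials and continuously differentiable functions\<close>

interpretation real_id: scalar_hom "\<lambda>a::real. a"
  by unfold_locales simp_all

definition rpoly :: "'n::finite mpoly \<Rightarrow> real ^ 'n \<Rightarrow> real" where
  "rpoly p x = mpoly_eval (\<lambda>a. a) (\<lambda>k. x $ k) p"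

text \<open>Induction on \<open>D\<close>: weights that annihilate the new vector \<open>d\<close>
  are scaled up and then raised by 1 in a coordinate where \<open>d\<close> is nonzero.\<close>

lemma exists_separating_weights:
  fixes D :: "('n::finite \<Rightarrow> int) set"
  assumes "finite D" "(\<lambda>_. 0) \<notin> D"
  shows "\<exists>e::'n \<Rightarrow> nat. \<forall>d\<in>D. (\<Sum>i\<in>UNIV. int (e i) * d i) \<noteq> 0"
  using assms
proof (induction D)
  case (insert d D)
  then obtain e :: "'n \<Rightarrow> nat" where e: "\<forall>d\<in>D. (\<Sum>i\<in>UNIV. int (e i) * d i) \<noteq> 0"
    by auto
  show ?case
  proof (cases "(\<Sum>i\<in>UNIV. int (e i) * d i) = 0")
    case False
    then show ?thesis using e by blast
  next
    case True
    have "d \<noteq> (\<lambda>_. 0)" using insert.prems by auto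
    then obtain j where j: "d j \<noteq> 0" by auto
    \<comment> \<open>\<open>K\<close> exceeds every \<open>\<bar>b j\<bar>\<close> with
      \<open>b\<close> in \<open>D\<close>. Hence \<open>K * <e, b> + b j = 0\<close> forces
      \<open>b j = 0\<close>, and then \<open><e, b> = 0\<close>, against the choice of
      \<open>e\<close>.\<close>
    define K where "K = nat (\<Sum>d\<in>D. \<bar>d j\<bar>) + 1"
    define e' where "e' i = K * e i + (if i = j then 1 else 0)" for i
    have e': "(\<Sum>i\<in>UNIV. int (e' i) * b i) = int K * (\<Sum>i\<in>UNIV. int (e i) * b i) + b j" for b
    proof -
      have "int (e' i) * b i = int K * (int (e i) * b i) + (if i = j then b i else 0)" for i
        by (simp add: e'_def algebra_simps)
      then show ?thesis by (simp add: sum.distrib sum_distrib_left)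
    qed
    have "(\<Sum>i\<in>UNIV. int (e' i) * b i) \<noteq> 0" if b: "b \<in> D" for b
    proof
      assume "(\<Sum>i\<in>UNIV. int (e' i) * b i) = 0"
      then have "int K dvd b j" unfolding e'
        by (metis add.commute add_eq_0_iff dvd_minus_iff dvd_triv_left minus_minus)
      moreover have "\<bar>b j\<bar> < int K"
      proof -
        have "\<bar>b j\<bar> \<le> (\<Sum>d\<in>D. \<bar>d j\<bar>)"
          using b insert.hyps by (intro member_le_sum) auto
        then show ?thesis by (simp add: K_def)
      qed
      ultimately have "b j = 0"
        using zdvd_not_zless[of "\<bar>b j\<bar>" "int K"] by (cases "b j = 0") auto
      moreover have "K > 0" by (simp add: K_def)
      ultimately show False
        using \<open>(\<Sum>i\<in>UNIV. int (e' i) * b i) = 0\<close> e b unfolding e' by simp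
    qed
    moreover have "(\<Sum>i\<in>UNIV. int (e' i) * d i) \<noteq> 0"
      unfolding e' using True j by simp
    ultimately show ?thesis by blast
  qed
qed simp

text \<open>
  Along the curve \<open>t \<mapsto> (a\<^sub>i t\<^bsup>e\<^sub>i\<^esup>)\<^sub>i\<close> through \<open>a\<close>, with weights \<open>e\<close> separating the exponents of
  \<open>p\<close>, the polynomial \<open>p\<close> becomes univariate without cancellation between its monomials.
\<close>

lemma rpoly_eventually_zero:
  fixes p :: "'n::finite mpoly"
  assumes a: "\<And>i. a $ i \<noteq> 0"
    and ev: "eventually (\<lambda>x. rpoly p x = 0) (nhds a)"
  shows "p = 0"
proof (rule ccontr)
  assume "p \<noteq> 0"
  let ?M = "Poly_Mapping.keys p"
  define diff where "diff = (\<lambda>(m :: 'n \<Rightarrow>\<^sub>0 nat, m' :: 'n \<Rightarrow>\<^sub>0 nat) i.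
    int (Poly_Mapping.lookup m i) - int (Poly_Mapping.lookup m' i))"
  define D where "D = diff ` {(m, m') \<in> ?M \<times> ?M. m \<noteq> m'}"
  have "finite {(m, m') \<in> ?M \<times> ?M. m \<noteq> m'}"
    by (rule finite_subset[of _ "?M \<times> ?M"]) auto
  then have "finite D" by (simp add: D_def)
  moreover have "(\<lambda>_. 0) \<notin> D"
    by (auto simp: D_def diff_def fun_eq_iff poly_mapping_eq_iff)
  ultimately obtain e :: "'n \<Rightarrow> nat" where e: "\<forall>d\<in>D. (\<Sum>i\<in>UNIV. int (e i) * d i) \<noteq> 0"
    using exists_separating_weights by blast
  define E where "E m = (\<Sum>i\<in>UNIV. e i * Poly_Mapping.lookup m i)" for m :: "'n \<Rightarrow>\<^sub>0 nat"
  have inj: "inj_on E ?M"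
  proof (rule inj_onI, rule ccontr)
    fix m m' assume m: "m \<in> ?M" "m' \<in> ?M" "E m = E m'" "m \<noteq> m'"
    then have "(\<Sum>i\<in>UNIV. int (e i) * diff (m, m') i) \<noteq> 0"
      using e by (auto simp: D_def)
    moreover have "(\<Sum>i\<in>UNIV. int (e i) * diff (m, m') i) = int (E m) - int (E m')"
      by (simp add: diff_def E_def algebra_simps sum_subtractf)
    ultimately show False using m by simp
  qed
  \<comment> \<open>The value at \<open>a\<close> of the monomial \<open>m\<close> with its
    coefficient. It is nonzero for every key \<open>m\<close> because no coordinate of
    \<open>a\<close> vanishes.\<close>
  define b where "b m = Poly_Mapping.lookup p m * (\<Prod>i\<in>UNIV. a $ i ^ Poly_Mapping.lookup m i)" for m
  define P where "P = (\<Sum>m\<in>?M. Polynomial.monom (b m) (E m))"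
  define c where "c t = (\<chi> i. a $ i * t ^ e i)" for t :: real
  have P: "poly P t = rpoly p (c t)" for t
    unfolding P_def rpoly_def mpoly_eval_def poly_sum poly_monom b_def E_def c_def
    by (simp add: power_mult_distrib prod.distrib power_sum power_mult mult.assoc)
  have "(c \<longlongrightarrow> a) (nhds 1)"
    unfolding c_def by (rule vec_tendstoI) (auto intro!: tendsto_eq_intros filterlim_ident)
  then have "eventually (\<lambda>t. poly P t = 0) (nhds 1)"
    using ev unfolding P filterlim_iff by blast
  then obtain d where d: "d > 0" "\<And>t. dist t 1 < d \<Longrightarrow> poly P t = 0"
    by (auto simp: eventually_nhds_metric)
  have "infinite {1<..<1 + d}" using d by simp
  moreover have "{1<..<1 + d} \<subseteq> {t. poly P t = 0}" using d by (auto simp: dist_real_def)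
  ultimately have "P = 0" using poly_roots_finite finite_subset by blast
  obtain m where m: "m \<in> ?M" using \<open>p \<noteq> 0\<close> by fastforce
  have "Polynomial.coeff P (E m) = (\<Sum>m'\<in>?M. if m' = m then b m' else 0)"
    unfolding P_def coeff_sum using inj m by (intro sum.cong) (auto simp: inj_on_def)
  also have "\<dots> = b m" using m by simp
  finally have "b m = 0" using \<open>P = 0\<close> by simp
  then show False using m a by (simp add: b_def in_keys_iff)
qed

text \<open>The gradient exists near \<open>a\<close> but is continuous only at \<open>a\<close>
  itself. This is preserved by the field operations and is just what local injectivity
  consumes.\<close>

definition C1_at :: "real ^ 'n::finite \<Rightarrow> (real ^ 'n \<Rightarrow> real) \<Rightarrow> bool" where
  "C1_at a f \<longleftrightarrow> (\<exists>G. eventually (\<lambda>x. GDERIV f x :> G x) (nhds a) \<and> isCont G a)"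

lemma C1_atE:
  assumes "C1_at a f"
  obtains G where "eventually (\<lambda>x. GDERIV f x :> G x) (nhds a)" "isCont G a" "isCont f a" "GDERIV f a :> G a"
proof -
  obtain G where G: "eventually (\<lambda>x. GDERIV f x :> G x) (nhds a)" "isCont G a"
    using assms by (auto simp: C1_at_def)
  then have "GDERIV f a :> G a" using eventually_nhds_x_imp_x by fast
  moreover from this have "isCont f a" by (auto simp: gderiv_def intro: has_derivative_continuous)
  ultimately show ?thesis using that G by blast
qed

lemma C1_at_cong:
  assumes "C1_at a f" "eventually (\<lambda>x. f x = g x) (nhds a)"
  shows "C1_at a g"
proof -
  obtain G where G: "eventually (\<lambda>x. GDERIV f x :> G x) (nhds a)" "isCont G a"
    using assms by (auto simp: C1_at_def)
  obtain T where T: "open T" "a \<in> T" "\<And>x. x \<in> T \<Longrightarrow> f x = g x \<and> GDERIV f x :> G x"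
    using eventually_conj[OF assms(2) G(1)] by (auto simp: eventually_nhds)
  have "GDERIV g x :> G x" if "x \<in> T" for x
    using T that has_derivative_transform_within_open[of f _ x UNIV T g] by (auto simp: gderiv_def)
  then show ?thesis using T G(2) unfolding C1_at_def eventually_nhds by blast
qed

lemma C1_at_const: "C1_at a (\<lambda>x. k)"
  unfolding C1_at_def by (rule exI[of _ "\<lambda>_. 0"]) (simp add: GDERIV_const)

lemma C1_at_component: "C1_at a (\<lambda>x. x $ i)"
proof -
  have "GDERIV (\<lambda>x. x $ i) x :> axis i 1" for x :: "real ^ 'a"
    unfolding gderiv_def by (simp add: inner_axis bounded_linear.has_derivative bounded_linear_vec_nth bounded_linear_imp_has_derivative)
  then show ?thesis unfolding C1_at_def by (intro exI[of _ "\<lambda>_. axis i 1"]) simp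
qed

lemma C1_at_add:
  assumes "C1_at a f" "C1_at a g"
  shows "C1_at a (\<lambda>x. f x + g x)"
proof -
  from assms obtain F G where "eventually (\<lambda>x. GDERIV f x :> F x) (nhds a)" "isCont F a"
    "eventually (\<lambda>x. GDERIV g x :> G x) (nhds a)" "isCont G a" by (auto simp: C1_at_def)
  then show ?thesis
    unfolding C1_at_def by (intro exI[of _ "\<lambda>x. F x + G x"]) (auto intro: GDERIV_add elim: eventually_elim2)
qed

lemma C1_at_mult:
  assumes "C1_at a f" "C1_at a g"
  shows "C1_at a (\<lambda>x. f x * g x)"
proof -
  obtain F where F: "eventually (\<lambda>x. GDERIV f x :> F x) (nhds a)" "isCont F a" "isCont f a"
    by (rule C1_atE[OF assms(1)])
  obtain G where G: "eventually (\<lambda>x. GDERIV g x :> G x) (nhds a)" "isCont G a" "isCont g a"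
    by (rule C1_atE[OF assms(2)])
  have "eventually (\<lambda>x. GDERIV (\<lambda>x. f x * g x) x :> (f x *\<^sub>R G x + g x *\<^sub>R F x)) (nhds a)"
    using F(1) G(1) by eventually_elim (rule GDERIV_mult)
  moreover have "isCont (\<lambda>x. f x *\<^sub>R G x + g x *\<^sub>R F x) a"
    using F G by (intro continuous_intros)
  ultimately show ?thesis unfolding C1_at_def by (intro exI conjI)
qed

lemma C1_at_inverse:
  assumes "C1_at a f" "f a \<noteq> 0"
  shows "C1_at a (\<lambda>x. inverse (f x))"
proof -
  obtain F where F: "eventually (\<lambda>x. GDERIV f x :> F x) (nhds a)" "isCont F a" "isCont f a"
    by (rule C1_atE[OF assms(1)])
  have "eventually (\<lambda>x. f x \<noteq> 0) (nhds a)"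
    using F(3) assms(2) by (metis continuous_at tendsto_at_iff_tendsto_nhds tendsto_imp_eventually_ne)
  with F(1) have "eventually (\<lambda>x. GDERIV (\<lambda>x. inverse (f x)) x :> (- (inverse (f x))\<^sup>2 *\<^sub>R F x)) (nhds a)"
    by eventually_elim (rule GDERIV_inverse)
  moreover have "isCont (\<lambda>x. - (inverse (f x))\<^sup>2 *\<^sub>R F x) a"
    using F assms(2) by (intro continuous_intros)
  ultimately show ?thesis unfolding C1_at_def by (intro exI conjI)
qed

lemma C1_at_sum: "(\<And>i. i \<in> I \<Longrightarrow> C1_at a (f i)) \<Longrightarrow> C1_at a (\<lambda>x. \<Sum>i\<in>I. f i x)"
  by (induction I rule: infinite_finite_induct) (auto intro: C1_at_const C1_at_add)

lemma C1_at_prod: "(\<And>i. i \<in> I \<Longrightarrow> C1_at a (f i)) \<Longrightarrow> C1_at a (\<lambda>x. \<Prod>i\<in>I. f i x)"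
  by (induction I rule: infinite_finite_induct) (auto intro: C1_at_const C1_at_mult)

lemma C1_at_power: "C1_at a f \<Longrightarrow> C1_at a (\<lambda>x. f x ^ k)"
  by (induction k) (auto intro: C1_at_const C1_at_mult)

lemma C1_at_rpoly: "C1_at a (rpoly p)"
  unfolding rpoly_def[abs_def] mpoly_eval_def
  by (intro C1_at_sum C1_at_mult C1_at_const C1_at_prod C1_at_power C1_at_component)

text \<open>The derivative at \<open>a\<close> is inverted by division by \<open>k\<close>, and
  continuity of the component gradients at \<open>a\<close> keeps the nearby derivatives close to it
  in operator norm. Multiples of the identity suffice: the map of interest is a sum of maps tangent
  to the identity.\<close>

lemma C1_at_locally_injective:
  fixes f :: "real ^ 'n::finite \<Rightarrow> real ^ 'n"
  assumes C1: "\<And>i. C1_at a (\<lambda>x. f x $ i)"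
    and der: "(f has_derivative (\<lambda>v. k *\<^sub>R v)) (at a)" and k: "k \<noteq> 0"
  obtains r where "r > 0" "inj_on f (ball a r)"
proof -
  have "\<exists>G. \<forall>i. eventually (\<lambda>x. GDERIV (\<lambda>x. f x $ i) x :> G i x) (nhds a) \<and> isCont (G i) a"
    using C1 unfolding C1_at_def by (intro choice allI)
  then obtain G where G: "\<And>i. eventually (\<lambda>x. GDERIV (\<lambda>x. f x $ i) x :> G i x) (nhds a)"
    "\<And>i. isCont (G i) a" by blast
  have "eventually (\<lambda>x. \<forall>i. GDERIV (\<lambda>x. f x $ i) x :> G i x) (nhds a)"
    using G(1) by (simp add: eventually_all_finite)
  then obtain T where T: "open T" "a \<in> T" "\<And>x i. x \<in> T \<Longrightarrow> GDERIV (\<lambda>x. f x $ i) x :> G i x"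
    by (auto simp: eventually_nhds)
  define f' where "f' x v = (\<chi> i. v \<bullet> G i x)" for x v
  have f': "(f has_derivative f' x) (at x)" if "x \<in> T" for x
    unfolding has_derivative_componentwise_within[of f] f'_def
    using T(3)[OF that] by (auto simp: Basis_vec_def inner_axis gderiv_def)
  have f'a: "f' a = (\<lambda>v. k *\<^sub>R v)"
    using f'[OF T(2)] der has_derivative_unique by blast
  show ?thesis
  proof (rule has_derivative_locally_injective[of a T "\<lambda>v. v /\<^sub>R k" f' f])
    show "bounded_linear (\<lambda>v::real^'n. v /\<^sub>R k)" by (rule bounded_linear_scaleR_right)
    show "(\<lambda>v. v /\<^sub>R k) \<circ> f' a = id" using k by (simp add: f'a fun_eq_iff)
    fix e :: real assume e: "e > 0"
    have "((\<lambda>x. \<Sum>i\<in>UNIV. norm (G i x - G i a)) \<longlongrightarrow> (\<Sum>i\<in>UNIV. norm (G i a - G i a))) (nhds a)"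
      using G(2) by (intro tendsto_intros) (simp add: continuous_at tendsto_at_iff_tendsto_nhds)
    then have "eventually (\<lambda>x. (\<Sum>i\<in>UNIV. norm (G i x - G i a)) < e) (nhds a)"
      using e by (intro order_tendstoD) auto
    then obtain d where d: "d > 0" "\<And>x. dist x a < d \<Longrightarrow> (\<Sum>i\<in>UNIV. norm (G i x - G i a)) < e"
      by (auto simp: eventually_nhds_metric)
    have "onorm (\<lambda>v. f' x v - f' a v) < e" if "dist a x < d" for x
    proof -
      \<comment> \<open>The l1 norm dominates the Euclidean one, and Cauchy-Schwarz bounds each
        component by the change of its gradient.\<close>
      have "onorm (\<lambda>v. f' x v - f' a v) \<le> (\<Sum>i\<in>UNIV. norm (G i x - G i a))"
      proof (rule onorm_le)
        fix v
        have "norm (f' x v - f' a v) \<le> (\<Sum>i\<in>UNIV. \<bar>(f' x v - f' a v) $ i\<bar>)"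
          by (rule norm_le_l1_cart)
        also have "\<dots> = (\<Sum>i\<in>UNIV. \<bar>v \<bullet> (G i x - G i a)\<bar>)"
          by (simp add: f'_def inner_diff_right)
        also have "\<dots> \<le> (\<Sum>i\<in>UNIV. norm (G i x - G i a) * norm v)"
          by (intro sum_mono) (metis Cauchy_Schwarz_ineq2 mult.commute)
        finally show "norm (f' x v - f' a v) \<le> (\<Sum>i\<in>UNIV. norm (G i x - G i a)) * norm v"
          by (simp add: sum_distrib_right)
      qed
      also have "\<dots> < e" using d that by (simp add: dist_commute)
      finally show ?thesis .
    qed
    with d show "\<exists>d>0. \<forall>x. dist a x < d \<longrightarrow> onorm (\<lambda>v. f' x v - f' a v) < e" by blast
  qed (use T f' that in auto)
qed

section \<open>Germs of rational functions at a point\<close>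

text \<open>A relation, since neither the fraction nor the function is canonical. The filter
  \<open>nhds a\<close> includes \<open>a\<close>, so the value \<open>f a\<close> is determined as
  well.\<close>

definition germ ::
    "real ^ 'n::{finite,linorder} \<Rightarrow> 'n ratfun \<Rightarrow> (real ^ 'n::{finite,linorder} \<Rightarrow> real) \<Rightarrow> bool" where
  "germ a r f \<longleftrightarrow> (\<exists>p q. r = Fract p q \<and> rpoly q a \<noteq> 0 \<and>
     eventually (\<lambda>x. f x = rpoly p x / rpoly q x) (nhds a))"

lemma tendsto_nhds_isCont: "isCont f a \<longleftrightarrow> (f \<longlongrightarrow> f a) (nhds a)"
  by (simp add: continuous_at tendsto_at_iff_tendsto_nhds)

lemma isCont_rpoly: "isCont (rpoly p) a"
  by (meson C1_atE C1_at_rpoly)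

lemma eventually_rpoly_nonzero: "rpoly q a \<noteq> 0 \<Longrightarrow> eventually (\<lambda>x. rpoly q x \<noteq> 0) (nhds a)"
  using isCont_rpoly[of a q] unfolding tendsto_nhds_isCont by (rule tendsto_imp_eventually_ne)

lemma rpoly_zero: "rpoly 0 x = 0"
  by (simp add: rpoly_def real_id.mpoly_eval_zero)

lemma rpoly_one: "rpoly 1 x = 1"
  by (simp add: rpoly_def real_id.mpoly_eval_one)

lemma rpoly_add: "rpoly (p + q) x = rpoly p x + rpoly q x"
  by (simp add: rpoly_def real_id.mpoly_eval_add)

lemma rpoly_mult: "rpoly (p * q) x = rpoly p x * rpoly q x"
  by (simp add: rpoly_def real_id.mpoly_eval_mult)

lemma rpoly_diff: "rpoly (p - q) x = rpoly p x - rpoly q x"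
  using rpoly_add[of "p - q" q x] by simp

lemma germ_cong: "germ a r f \<Longrightarrow> eventually (\<lambda>x. f x = g x) (nhds a) \<Longrightarrow> germ a r g"
  unfolding germ_def by (elim exE conjE, intro exI conjI, assumption, assumption)
    (auto elim: eventually_elim2)

lemma germ_const: "germ a (const_rf c) (\<lambda>x. c)"
  unfolding germ_def const_rf_def
  by (rule exI[of _ "Poly_Mapping.single 0 c"], rule exI[of _ 1])
    (simp add: rpoly_one, simp add: rpoly_def real_id.mpoly_eval_single)

lemma germ_var: "germ a (var_rf i) (\<lambda>x. x $ i)"
  unfolding germ_def var_rf_def
  by (intro exI[of _ "Poly_Mapping.single (Poly_Mapping.single i 1) 1"] exI[of _ 1])
    (simp only: rpoly_one rpoly_def real_id.mpoly_eval_var real_id.mpoly_eval_one, simp)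

lemma germ_add:
  assumes "germ a r f" "germ a s g"
  shows "germ a (r + s) (\<lambda>x. f x + g x)"
proof -
  from assms obtain p q p' q' where *: "r = Fract p q" "rpoly q a \<noteq> 0"
    "eventually (\<lambda>x. f x = rpoly p x / rpoly q x) (nhds a)"
    "s = Fract p' q'" "rpoly q' a \<noteq> 0" "eventually (\<lambda>x. g x = rpoly p' x / rpoly q' x) (nhds a)"
    unfolding germ_def by blast
  then have "r + s = Fract (p * q' + p' * q) (q * q')"
    using rpoly_zero by (metis add_fract)
  moreover have "eventually (\<lambda>x. f x + g x = rpoly (p * q' + p' * q) x / rpoly (q * q') x) (nhds a)"
    using *(3,6) eventually_rpoly_nonzero[OF *(2)] eventually_rpoly_nonzero[OF *(5)]
    by eventually_elim (simp add: rpoly_add rpoly_mult field_simps)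
  ultimately show ?thesis
    unfolding germ_def using * by (intro exI[of _ "p * q' + p' * q"] exI[of _ "q * q'"]) (simp add: rpoly_mult)
qed

lemma germ_mult:
  assumes "germ a r f" "germ a s g"
  shows "germ a (r * s) (\<lambda>x. f x * g x)"
proof -
  from assms obtain p q p' q' where *: "r = Fract p q" "rpoly q a \<noteq> 0"
    "eventually (\<lambda>x. f x = rpoly p x / rpoly q x) (nhds a)"
    "s = Fract p' q'" "rpoly q' a \<noteq> 0" "eventually (\<lambda>x. g x = rpoly p' x / rpoly q' x) (nhds a)"
    unfolding germ_def by blast
  have "eventually (\<lambda>x. f x * g x = rpoly (p * p') x / rpoly (q * q') x) (nhds a)"
    using *(3,6) by eventually_elim (simp add: rpoly_mult)
  then show ?thesis
    unfolding germ_def using * by (intro exI[of _ "p * p'"] exI[of _ "q * q'"]) (simp add: rpoly_mult)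
qed

lemma germ_inverse:
  assumes "germ a r f" "f a \<noteq> 0"
  shows "germ a (inverse r) (\<lambda>x. inverse (f x))"
proof -
  from assms obtain p q where *: "r = Fract p q" "rpoly q a \<noteq> 0"
    "eventually (\<lambda>x. f x = rpoly p x / rpoly q x) (nhds a)"
    unfolding germ_def by blast
  have "rpoly p a \<noteq> 0"
    using eventually_nhds_x_imp_x[OF *(3)] assms by auto
  moreover have "eventually (\<lambda>x. inverse (f x) = rpoly q x / rpoly p x) (nhds a)"
    using *(3) by eventually_elim simp
  ultimately show ?thesis
    unfolding germ_def using * by (intro exI[of _ q] exI[of _ p]) simp
qed

lemma germ_divide: "germ a r f \<Longrightarrow> germ a s g \<Longrightarrow> g a \<noteq> 0 \<Longrightarrow> germ a (r / s) (\<lambda>x. f x / g x)"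
  unfolding divide_inverse by (intro germ_mult germ_inverse)

lemma germ_zero: "germ a 0 (\<lambda>x. 0)"
  using germ_const[of a 0] by (simp add: const_rf.zero)

lemma germ_one: "germ a 1 (\<lambda>x. 1)"
  using germ_const[of a 1] by (simp add: const_rf.one)

lemma germ_sum: "(\<And>i. i \<in> I \<Longrightarrow> germ a (r i) (f i)) \<Longrightarrow> germ a (\<Sum>i\<in>I. r i) (\<lambda>x. \<Sum>i\<in>I. f i x)"
  by (induction I rule: infinite_finite_induct) (auto intro: germ_zero germ_add)

lemma germ_prod: "(\<And>i. i \<in> I \<Longrightarrow> germ a (r i) (f i)) \<Longrightarrow> germ a (\<Prod>i\<in>I. r i) (\<lambda>x. \<Prod>i\<in>I. f i x)"
  by (induction I rule: infinite_finite_induct) (auto intro: germ_one germ_mult)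

lemma germ_power: "germ a r f \<Longrightarrow> germ a (r ^ k) (\<lambda>x. f x ^ k)"
  by (induction k) (auto intro: germ_one germ_mult)

lemma germ_power_int: "germ a r f \<Longrightarrow> f a \<noteq> 0 \<Longrightarrow> germ a (r powi k) (\<lambda>x. f x powi k)"
  unfolding power_int_def by (auto intro: germ_power germ_inverse)

lemma germ_unique:
  assumes "germ a r f" "germ a r g"
  shows "eventually (\<lambda>x. f x = g x) (nhds a)"
proof -
  from assms obtain p q p' q' where *: "r = Fract p q" "rpoly q a \<noteq> 0"
    "eventually (\<lambda>x. f x = rpoly p x / rpoly q x) (nhds a)"
    "r = Fract p' q'" "rpoly q' a \<noteq> 0" "eventually (\<lambda>x. g x = rpoly p' x / rpoly q' x) (nhds a)"
    unfolding germ_def by blast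
  moreover have "q \<noteq> 0" "q' \<noteq> 0" using * rpoly_zero by metis+
  ultimately have "p * q' = p' * q" by (metis eq_fract(1))
  then have eq: "rpoly p x * rpoly q' x = rpoly p' x * rpoly q x" for x by (metis rpoly_mult)
  show ?thesis
    using *(3,6) eventually_rpoly_nonzero[OF *(2)] eventually_rpoly_nonzero[OF *(5)]
    by eventually_elim (simp add: frac_eq_eq eq)
qed

lemma germ_unique_at: "germ a r f \<Longrightarrow> germ a r g \<Longrightarrow> f a = g a"
  using germ_unique eventually_nhds_x_imp_x by blast

text \<open>The cross difference of the two fractions is a polynomial vanishing near
  \<open>a\<close>, hence zero. Through this lemma, computations with real functions prove
  equalities of rational functions.\<close>

lemma germ_inject:
  assumes a: "\<And>i. a $ i \<noteq> 0" and "germ a r f" "germ a s f"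
  shows "r = s"
proof -
  from assms obtain p q p' q' where *: "r = Fract p q" "rpoly q a \<noteq> 0"
    "eventually (\<lambda>x. f x = rpoly p x / rpoly q x) (nhds a)"
    "s = Fract p' q'" "rpoly q' a \<noteq> 0" "eventually (\<lambda>x. f x = rpoly p' x / rpoly q' x) (nhds a)"
    unfolding germ_def by blast
  have "eventually (\<lambda>x. rpoly (p * q' - p' * q) x = 0) (nhds a)"
    using *(3,6) eventually_rpoly_nonzero[OF *(2)] eventually_rpoly_nonzero[OF *(5)]
    by eventually_elim (simp add: frac_eq_eq rpoly_mult rpoly_diff)
  then have "p * q' - p' * q = 0" by (rule rpoly_eventually_zero[OF a])
  moreover have "q \<noteq> 0" "q' \<noteq> 0" using * rpoly_zero by metis+
  ultimately show ?thesis using * by (simp add: eq_fract)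
qed

lemma C1_at_germ:
  assumes "germ a r f"
  shows "C1_at a f"
proof -
  from assms obtain p q where *: "rpoly q a \<noteq> 0"
    "eventually (\<lambda>x. f x = rpoly p x / rpoly q x) (nhds a)"
    unfolding germ_def by blast
  have "C1_at a (\<lambda>x. rpoly p x * inverse (rpoly q x))"
    by (intro C1_at_mult C1_at_inverse C1_at_rpoly *)
  then show ?thesis
    by (rule C1_at_cong) (use *(2) in \<open>eventually_elim, simp add: divide_inverse\<close>)
qed

lemma isCont_germ: "germ a r f \<Longrightarrow> isCont f a"
  by (meson C1_atE C1_at_germ)

lemma tendsto_tuple_germs:
  assumes "\<And>i. germ a (g i) (\<gamma> i)" "\<And>i. \<gamma> i a = a $ i"
  shows "((\<lambda>x. \<chi> i. \<gamma> i x) \<longlongrightarrow> a) (nhds a)"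
  by (rule vec_tendstoI) (use isCont_germ[OF assms(1)] assms(2) in \<open>simp add: tendsto_nhds_isCont\<close>)

lemma germ_mpoly_eval:
  assumes "\<And>i. germ a (g i) (\<gamma> i)"
  shows "germ a (mpoly_eval const_rf g p) (\<lambda>x. rpoly p (\<chi> i. \<gamma> i x))"
  unfolding mpoly_eval_def rpoly_def
  by (simp, intro germ_sum germ_mult germ_const germ_prod germ_power assms)

text \<open>Because the inner tuple sends \<open>a\<close> to \<open>a\<close>, a denominator of
  \<open>r\<close> nonzero at \<open>a\<close> stays nonzero after substitution. The agreement of
  \<open>f\<close> with its fraction near \<open>a\<close> is then pulled back along the tuple,
  which tends to \<open>a\<close>.\<close>

lemma germ_subst_rf:
  assumes r: "germ a r f" and g: "\<And>i. germ a (g i) (\<gamma> i)" "\<And>i. \<gamma> i a = a $ i"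
  shows "germ a (subst_rf g r) (\<lambda>x. f (\<chi> i. \<gamma> i x))"
proof -
  from r obtain p q where *: "r = Fract p q" "rpoly q a \<noteq> 0"
    "eventually (\<lambda>x. f x = rpoly p x / rpoly q x) (nhds a)"
    unfolding germ_def by blast
  have a: "(\<chi> i. \<gamma> i a) = a" by (simp add: g vec_eq_iff)
  have gq: "germ a (mpoly_eval const_rf g q) (\<lambda>x. rpoly q (\<chi> i. \<gamma> i x))"
    by (rule germ_mpoly_eval[OF g(1)])
  \<comment> \<open>Otherwise its germ would be that of 0, but its value at \<open>a\<close> is
    \<open>rpoly q a\<close>.\<close>
  have "mpoly_eval const_rf g q \<noteq> 0"
    using germ_unique_at[OF gq] germ_zero[of a] *(2) a by fastforce
  then have s: "subst_rf g r = mpoly_eval const_rf g p / mpoly_eval const_rf g q"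
    unfolding * by (rule subst_rf_eqI)
  have q: "germ a (mpoly_eval const_rf g p / mpoly_eval const_rf g q) (\<lambda>x. rpoly p (\<chi> i. \<gamma> i x) / rpoly q (\<chi> i. \<gamma> i x))"
    using *(2) a by (intro germ_divide germ_mpoly_eval g) simp
  have ev: "eventually (\<lambda>x. rpoly p (\<chi> i. \<gamma> i x) / rpoly q (\<chi> i. \<gamma> i x) = f (\<chi> i. \<gamma> i x)) (nhds a)"
    using tendsto_tuple_germs[OF g] eventually_mono[OF *(3), of "\<lambda>x. rpoly p x / rpoly q x = f x"]
    unfolding filterlim_iff by auto
  show ?thesis unfolding s by (rule germ_cong[OF q ev])
qed

section \<open>Rational maps regular at a fixed point, and their derivatives there\<close>

definition fixes_germ :: "real ^ 'n::{finite,linorder} \<Rightarrow> ('n \<Rightarrow> 'n ratfun) \<Rightarrow> bool" where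
  "fixes_germ a g \<longleftrightarrow> (\<forall>i. \<exists>f. germ a (g i) f \<and> f a = a $ i)"

text \<open>The choice picks one real function per component. For maps in \<open>fixes_germ\<close>
  another choice would agree with it near \<open>a\<close>, so its value and derivative at
  \<open>a\<close> are canonical.\<close>

definition rf_map ::
    "real ^ 'n::{finite,linorder} \<Rightarrow> ('n \<Rightarrow> 'n ratfun) \<Rightarrow>
      real ^ 'n::{finite,linorder} \<Rightarrow> real ^ 'n::{finite,linorder}" where
  "rf_map a g x = (\<chi> i. (SOME f. germ a (g i) f) x)"

definition rf_deriv ::
    "real ^ 'n::{finite,linorder} \<Rightarrow> ('n \<Rightarrow> 'n ratfun) \<Rightarrow>
      real ^ 'n::{finite,linorder} \<Rightarrow> real ^ 'n::{finite,linorder}" where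
  "rf_deriv a g = frechet_derivative (rf_map a g) (at a)"

lemma fixes_germI: "(\<And>i. germ a (g i) (\<lambda>x. \<gamma> x $ i)) \<Longrightarrow> \<gamma> a = a \<Longrightarrow> fixes_germ a g"
  unfolding fixes_germ_def by metis

lemma germ_rf_map:
  assumes "fixes_germ a g"
  shows "germ a (g i) (\<lambda>x. rf_map a g x $ i)"
  using assms someI_ex[of "germ a (g i)"] by (auto simp: fixes_germ_def rf_map_def)

lemma rf_map_at:
  assumes "fixes_germ a g"
  shows "rf_map a g a = a"
proof -
  have "rf_map a g a $ i = a $ i" for i
  proof -
    obtain f where "germ a (g i) f" "f a = a $ i" using assms by (auto simp: fixes_germ_def)
    then show ?thesis using germ_unique_at[OF germ_rf_map[OF assms]] by metis
  qed
  then show ?thesis by (simp add: vec_eq_iff)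
qed

lemma eventually_vec_eq:
  fixes f g :: "'b \<Rightarrow> 'a ^ 'n::finite"
  shows "(\<And>i. eventually (\<lambda>x. f x $ i = g x $ i) F) \<Longrightarrow> eventually (\<lambda>x. f x = g x) F"
  by (simp add: vec_eq_iff eventually_all_finite)

lemma rf_map_unique:
  assumes "\<And>i. germ a (g i) (\<lambda>x. \<gamma> x $ i)" "\<gamma> a = a"
  shows "eventually (\<lambda>x. rf_map a g x = \<gamma> x) (nhds a)"
  by (intro eventually_vec_eq germ_unique[OF germ_rf_map assms(1)] fixes_germI[of a g \<gamma>] assms)

lemma rf_map_has_derivative:
  assumes "fixes_germ a g"
  shows "(rf_map a g has_derivative rf_deriv a g) (at a)"
proof -
  have "\<exists>D. ((\<lambda>x. rf_map a g x $ i) has_derivative D) (at a)" for i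
    using C1_at_germ[OF germ_rf_map[OF assms], of i] by (auto elim!: C1_atE simp: gderiv_def)
  then obtain D where "\<And>i. ((\<lambda>x. rf_map a g x $ i) has_derivative D i) (at a)" by metis
  then have "(rf_map a g has_derivative (\<lambda>v. \<chi> i. D i v)) (at a)"
    unfolding has_derivative_componentwise_within[of "rf_map a g"]
    by (auto simp: Basis_vec_def inner_axis)
  then show ?thesis
    unfolding rf_deriv_def using differentiableI frechet_derivative_works by blast
qed

lemma has_derivative_cong_nhds:
  assumes "(f has_derivative D) (at a)" "eventually (\<lambda>x. f x = g x) (nhds a)"
  shows "(g has_derivative D) (at a)"
  using assms has_derivative_transform_within_open[of f D a UNIV _ g] unfolding eventually_nhds by blast

lemma rf_deriv_eqI:
  assumes "\<And>i. germ a (g i) (\<lambda>x. \<gamma> x $ i)" "\<gamma> a = a" "(\<gamma> has_derivative D) (at a)"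
  shows "rf_deriv a g = D"
  using has_derivative_cong_nhds[OF rf_map_has_derivative rf_map_unique, OF fixes_germI, OF assms(1,2,1,2)]
    assms(3) has_derivative_unique by blast

lemma germ_rat_comp:
  assumes "germ a (f i) (\<lambda>x. \<phi> x $ i)" "\<And>i. germ a (g i) (\<lambda>x. \<gamma> x $ i)" "\<gamma> a = a"
  shows "germ a (rat_comp f g i) (\<lambda>x. \<phi> (\<gamma> x) $ i)"
  using germ_subst_rf[of a "f i" "\<lambda>x. \<phi> x $ i" g "\<lambda>i x. \<gamma> x $ i"] assms by (simp add: rat_comp_def)

lemma fixes_germ_rat_comp: "fixes_germ a f \<Longrightarrow> fixes_germ a g \<Longrightarrow> fixes_germ a (rat_comp f g)"
  by (rule fixes_germI[of _ _ "\<lambda>x. rf_map a f (rf_map a g x)"],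
      rule germ_rat_comp[of a f _ "rf_map a f" g "rf_map a g"])
    (simp_all add: germ_rf_map rf_map_at)

text \<open>The chain rule, with both derivatives taken at the same point because \<open>a\<close>
  is fixed; this is why differentiation is multiplicative.\<close>

lemma rf_deriv_rat_comp:
  assumes "fixes_germ a f" "fixes_germ a g"
  shows "rf_deriv a (rat_comp f g) = rf_deriv a f \<circ> rf_deriv a g"
proof (rule rf_deriv_eqI)
  show "germ a (rat_comp f g i) (\<lambda>x. (rf_map a f \<circ> rf_map a g) x $ i)" for i
    using germ_rat_comp[of a f i "rf_map a f" g "rf_map a g"] by (simp add: germ_rf_map rf_map_at assms)
  show "(rf_map a f \<circ> rf_map a g) a = a" by (simp add: rf_map_at assms)
  show "(rf_map a f \<circ> rf_map a g has_derivative rf_deriv a f \<circ> rf_deriv a g) (at a)"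
    by (rule diff_chain_at) (simp_all add: rf_map_has_derivative rf_map_at assms)
qed

lemma fixes_germ_var: "fixes_germ a var_rf"
  by (rule fixes_germI[of _ _ id]) (auto intro: germ_var)

lemma rf_deriv_var: "rf_deriv a var_rf = id"
  by (rule rf_deriv_eqI[of _ _ id]) (auto intro: germ_var has_derivative_ident simp: id_def)

text \<open>\<open>h m\<close> stands for the \<open>m\<close>-th power of \<open>g\<close>. Its
  chosen real function is the \<open>m\<close>-fold iterate only near \<open>a\<close>, so
  invariance of \<open>\<psi>\<close> rests on finitely many eventual equalities, one for each
  \<open>m\<close> below \<open>N\<close>.\<close>

lemma finite_order_tangent_identity:
  fixes h :: "nat \<Rightarrow> 'n::{finite,linorder} \<Rightarrow> 'n ratfun"
  assumes a: "\<And>i. a $ i \<noteq> 0"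
    and g: "fixes_germ a g" "rf_deriv a g = id"
    and h: "h 0 = var_rf" "\<And>m. h (Suc m) = rat_comp (h m) g" "h N = var_rf" and N: "N > 0"
  shows "g = var_rf"
proof -
  define \<gamma> where "\<gamma> = rf_map a g"
  have pow: "fixes_germ a (h m) \<and> rf_deriv a (h m) = id" for m
    by (induction m) (auto simp: h fixes_germ_var rf_deriv_var fixes_germ_rat_comp rf_deriv_rat_comp g)
  define \<psi> where "\<psi> x = (\<Sum>m<N. rf_map a (h m) x)" for x
  have "C1_at a (\<lambda>x. \<psi> x $ i)" for i
    unfolding \<psi>_def by (simp, intro C1_at_sum C1_at_germ[OF germ_rf_map]) (simp add: pow)
  moreover have "(\<psi> has_derivative (\<lambda>v. real N *\<^sub>R v)) (at a)"
  proof -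
    have "(\<psi> has_derivative (\<lambda>v. \<Sum>m<N. rf_deriv a (h m) v)) (at a)"
      unfolding \<psi>_def by (intro has_derivative_sum rf_map_has_derivative) (simp add: pow)
    then show ?thesis by (simp add: pow scaleR_conv_of_real sum_constant_scaleR)
  qed
  ultimately obtain r where r: "r > 0" "inj_on \<psi> (ball a r)"
    using C1_at_locally_injective[of a \<psi> "real N"] N by auto
  have lim: "(\<gamma> \<longlongrightarrow> a) (nhds a)"
    using tendsto_tuple_germs[of a g "\<lambda>i x. \<gamma> x $ i"] by (simp add: \<gamma>_def germ_rf_map g rf_map_at)
  have "eventually (\<lambda>x. rf_map a (h (Suc m)) x = rf_map a (h m) (\<gamma> x)) (nhds a)" for m
    unfolding h(2) \<gamma>_def by (rule rf_map_unique, rule germ_rat_comp) (simp_all add: pow germ_rf_map g rf_map_at)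
  then have "eventually (\<lambda>x. \<forall>m\<in>{..<N}. rf_map a (h (Suc m)) x = rf_map a (h m) (\<gamma> x)) (nhds a)"
    by (intro eventually_ball_finite) auto
  then have "eventually (\<lambda>x. \<psi> (\<gamma> x) = \<psi> x) (nhds a)"
  proof eventually_elim
    case (elim x)
    have "\<psi> (\<gamma> x) = (\<Sum>m<N. rf_map a (h (Suc m)) x)"
      using elim by (simp add: \<psi>_def)
    \<comment> \<open>Shifting the index exchanges the term for 0 against the term for
      \<open>N\<close>; both are powers equal to \<open>var_rf\<close>, so they cancel.\<close>
    also have "\<dots> + rf_map a (h 0) x = \<psi> x + rf_map a (h N) x"
      using sum.lessThan_Suc_shift[of "\<lambda>m. rf_map a (h m) x" N] by (simp add: \<psi>_def add.commute)
    finally show ?case by (simp add: h)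
  qed
  moreover have "eventually (\<lambda>x. x \<in> ball a r) (nhds a)"
    using r by (intro eventually_nhds_in_open) auto
  moreover have "eventually (\<lambda>x. \<gamma> x \<in> ball a r) (nhds a)"
    using lim r by (intro topological_tendstoD) auto
  ultimately have "eventually (\<lambda>x. \<gamma> x = x) (nhds a)"
    by eventually_elim (use r(2) in \<open>auto simp: inj_on_def\<close>)
  then have "germ a (g i) (\<lambda>x. x $ i)" for i
    using germ_rf_map[OF g(1), of i] unfolding \<gamma>_def
    by (rule_tac germ_cong) (auto elim: eventually_mono)
  then show ?thesis
    using germ_inject[OF a] germ_var by blast
qed

section \<open>Positive definite square roots and reflections\<close>

text \<open>A maximizer of the Rayleigh quotient on the unit sphere of \<open>W\<close> is an
  eigenvector, with the maximum as eigenvalue.\<close>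

lemma self_adjoint_eigenvector:
  fixes f :: "'a::euclidean_space \<Rightarrow> 'a"
  assumes f: "linear f" and adj: "\<And>x y. f x \<bullet> y = x \<bullet> f y"
    and W: "subspace W" "f ` W \<subseteq> W" "\<not> W \<subseteq> {0}"
  obtains v where "v \<in> W" "norm v = 1" "f v = (v \<bullet> f v) *\<^sub>R v"
proof -
  have "compact (sphere 0 1 \<inter> W)"
    by (intro compact_Int_closed closed_subspace W) simp
  moreover have "sphere 0 1 \<inter> W \<noteq> {}"
  proof -
    obtain w where "w \<in> W" "w \<noteq> 0" using W(3) by auto
    then have "w /\<^sub>R norm w \<in> sphere 0 1 \<inter> W" using W(1) by (auto intro: subspace_scale)
    then show ?thesis by blast
  qed
  moreover have "continuous_on (sphere 0 1 \<inter> W) (\<lambda>x. x \<bullet> f x)"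
    using f by (intro continuous_intros linear_continuous_on) (simp add: linear_conv_bounded_linear)
  ultimately obtain v where v: "v \<in> sphere 0 1 \<inter> W"
    and max: "\<And>x. x \<in> sphere 0 1 \<inter> W \<Longrightarrow> x \<bullet> f x \<le> v \<bullet> f v"
    using continuous_attains_sup by metis
  define l where "l = v \<bullet> f v"
  have quad: "x \<bullet> f x \<le> l * (x \<bullet> x)" if "x \<in> W" for x
  proof (cases "x = 0")
    case True
    then show ?thesis using f by simp
  next
    case False
    then have "x /\<^sub>R norm x \<in> sphere 0 1 \<inter> W" using that W(1) by (auto intro: subspace_scale)
    from max[OF this] have "(x \<bullet> f x) / (norm x)\<^sup>2 \<le> l"
      using f by (simp add: l_def linear_scale power2_eq_square divide_inverse mult_ac)
    then show ?thesis using False by (simp add: field_simps power2_norm_eq_inner)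
  qed
  have orth: "(f v - l *\<^sub>R v) \<bullet> w = 0" if w: "w \<in> W" for w
  proof -
    define b where "b = (f v - l *\<^sub>R v) \<bullet> w"
    define c where "c = l * (w \<bullet> w) - w \<bullet> f w"
    have vv: "v \<bullet> v = 1" using v by (simp add: norm_eq_1)
    \<comment> \<open>Expand the bound \<open>quad\<close> at \<open>v + t w\<close>; at
      \<open>v\<close> itself it is an equality, so only the linear and quadratic terms in
      \<open>t\<close> remain.\<close>
    have ineq: "2 * t * b \<le> t\<^sup>2 * c" for t
    proof -
      have "v + t *\<^sub>R w \<in> W" using v w W(1) by (auto intro: subspace_add subspace_scale)
      from quad[OF this] have "(v + t *\<^sub>R w) \<bullet> (f v + t *\<^sub>R f w) \<le> l * ((v + t *\<^sub>R w) \<bullet> (v + t *\<^sub>R w))"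
        using f by (simp add: linear_add linear_scale)
      moreover have "v \<bullet> f w = f v \<bullet> w" using adj by simp
      ultimately show ?thesis
        using vv by (simp add: b_def c_def inner_add inner_diff inner_commute l_def[symmetric]
            power2_eq_square algebra_simps)
    qed
    have c0: "c \<ge> 0" using quad[OF w] by (simp add: c_def)
    \<comment> \<open>With this \<open>t\<close> the inequality becomes
      \<open>t^2 * (c + 2) \<le> 0\<close>; the added 1 keeps the denominator positive when
      \<open>c = 0\<close>.\<close>
    define t where "t = b / (c + 1)"
    have b: "b = t * (c + 1)" using c0 by (simp add: t_def)
    have "t\<^sup>2 * (c + 2) \<le> 0" using ineq[of t] by (simp add: b algebra_simps power2_eq_square)
    then have "t = 0" using c0 by (simp add: mult_le_0_iff)
    then show ?thesis using b by (simp add: b_def)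
  qed
  have "f v - l *\<^sub>R v \<in> W" using v W by (auto intro!: subspace_diff subspace_scale)
  then have "f v = l *\<^sub>R v" using orth by (metis eq_iff_diff_eq_0 inner_eq_zero_iff)
  then show ?thesis using that v by (auto simp: l_def)
qed

text \<open>Eigenvectors are added one at a time: by self-adjointness the orthogonal complement
  \<open>W\<close> of those already found is invariant, and it is nonzero while there are fewer than
  \<open>DIM('a)\<close> of them.\<close>

lemma self_adjoint_eigenbasis:
  fixes f :: "'a::euclidean_space \<Rightarrow> 'a"
  assumes f: "linear f" and adj: "\<And>x y. f x \<bullet> y = x \<bullet> f y"
  obtains E where "finite E" "pairwise orthogonal E" "\<And>e. e \<in> E \<Longrightarrow> norm e = 1"
    "\<And>e. e \<in> E \<Longrightarrow> f e = (e \<bullet> f e) *\<^sub>R e" "span E = UNIV"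
proof -
  define P where "P E \<longleftrightarrow> finite E \<and> pairwise orthogonal E \<and> (\<forall>e\<in>E. norm e = 1) \<and>
    (\<forall>e\<in>E. f e = (e \<bullet> f e) *\<^sub>R e)" for E
  have "\<exists>E. P E \<and> card E = n" if "n \<le> DIM('a)" for n
    using that
  proof (induction n)
    case 0
    then show ?case by (intro exI[of _ "{}"]) (auto simp: P_def)
  next
    case (Suc n)
    then obtain E where E: "P E" "card E = n" by auto
    then have fE: "finite E" by (simp add: P_def)
    define W where "W = {x. \<forall>e\<in>E. e \<bullet> x = 0}"
    have "dim E < DIM('a)"
      using dim_le_card'[of E] fE E Suc.prems by auto
    then obtain x where x: "x \<noteq> 0" "\<And>y. y \<in> span E \<Longrightarrow> orthogonal x y"
      using orthogonal_to_subspace_exists by blast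
    then have "x \<in> W" by (auto simp: W_def orthogonal_def span_base inner_commute)
    have "subspace W" by (auto simp: W_def subspace_def inner_add)
    moreover have "f ` W \<subseteq> W"
    proof -
      have "e \<bullet> f y = 0" if "y \<in> W" "e \<in> E" for y e
      proof -
        have "f e = (e \<bullet> f e) *\<^sub>R e" using E that by (simp add: P_def)
        then have "e \<bullet> f y = (e \<bullet> f e) * (e \<bullet> y)" by (metis adj inner_scaleR_left)
        then show ?thesis using that by (simp add: W_def)
      qed
      then show ?thesis by (auto simp: W_def)
    qed
    ultimately obtain v where v: "v \<in> W" "norm v = 1" "f v = (v \<bullet> f v) *\<^sub>R v"
      using self_adjoint_eigenvector[OF f adj] \<open>x \<in> W\<close> x(1) by blast
    have "v \<notin> E" using v by (auto simp: W_def)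
    then have "card (insert v E) = Suc n" using fE E by simp
    moreover have "P (insert v E)"
      using E v by (auto simp: P_def pairwise_insert W_def orthogonal_def inner_commute)
    ultimately show ?case by blast
  qed
  then obtain E where E: "P E" "card E = DIM('a)" by blast
  then have "independent E"
    by (intro pairwise_orthogonal_independent) (auto simp: P_def)
  then have "span E = UNIV"
    using E card_ge_dim_independent[of E UNIV] by (auto simp: P_def)
  then show ?thesis using that E by (auto simp: P_def)
qed

lemma matrix_vector_mult_self_adjoint:
  fixes A :: "real ^ 'n ^ 'n"
  shows "transpose A = A \<Longrightarrow> (A *v x) \<bullet> y = x \<bullet> (A *v y)"
  by (metis dot_lmul_matrix vector_transpose_matrix)

text \<open>In an orthonormal eigenbasis each eigenvalue is replaced by its square root. Positivity
  then needs some basis vector not orthogonal to \<open>v\<close>, which exists because the basis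
  spans.\<close>

lemma pos_def_sqrt_exists:
  fixes A :: "real ^ 'n ^ 'n"
  assumes "pos_def_matrix A"
  shows "\<exists>B. pos_def_matrix B \<and> B ** B = A"
proof -
  define f where "f x = A *v x" for x
  have f: "linear f" unfolding f_def by (rule matrix_vector_mul_linear)
  have adj: "f x \<bullet> y = x \<bullet> f y" for x y
    using assms by (simp add: f_def pos_def_matrix_def matrix_vector_mult_self_adjoint)
  obtain E where E: "finite E" "pairwise orthogonal E" "\<And>e. e \<in> E \<Longrightarrow> norm e = 1"
    "\<And>e. e \<in> E \<Longrightarrow> f e = (e \<bullet> f e) *\<^sub>R e" "span E = UNIV"
    using self_adjoint_eigenbasis[OF f adj] by blast
  have pos: "e \<bullet> f e > 0" if "e \<in> E" for e
  proof -
    have "e \<noteq> 0" using E(3)[OF that] by auto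
    then show ?thesis using assms by (simp add: f_def pos_def_matrix_def)
  qed
  define g where "g v = (\<Sum>e\<in>E. (sqrt (e \<bullet> f e) * (e \<bullet> v)) *\<^sub>R e)" for v
  have g: "linear g"
    unfolding g_def by (intro linearI)
      (simp_all add: inner_add_right algebra_simps sum.distrib scaleR_sum_right)
  have ge: "g e = sqrt (e \<bullet> f e) *\<^sub>R e" if e: "e \<in> E" for e
  proof -
    have "g e = (\<Sum>b\<in>E. if b = e then sqrt (e \<bullet> f e) *\<^sub>R e else 0)"
      unfolding g_def using E(2,3) e
      by (intro sum.cong) (auto simp: pairwise_def orthogonal_def norm_eq_1)
    also have "\<dots> = sqrt (e \<bullet> f e) *\<^sub>R e" using E(1) e by simp
    finally show ?thesis .
  qed
  have gg: "g (g v) = f v" for v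
  proof -
    have "(g \<circ> g) v = f v"
    proof (rule linear_eq_on_span[of "g \<circ> g" f E v])
      show "linear (g \<circ> g)" using g by (simp add: linear_compose)
      fix e assume e: "e \<in> E"
      have "(g \<circ> g) e = (e \<bullet> f e) *\<^sub>R e" using e pos[OF e] by (simp add: ge linear_scale[OF g])
      then show "(g \<circ> g) e = f e" using E(4)[OF e] by simp
    qed (use f E in auto)
    then show ?thesis by simp
  qed
  define B where "B = matrix g"
  have B: "B *v x = g x" for x using g by (simp add: B_def matrix_works)
  have "B ** B = A"
    unfolding matrix_eq by (simp add: B gg f_def flip: matrix_vector_mul_assoc)
  moreover have "transpose B = B"
  proof -
    have "g x \<bullet> y = x \<bullet> g y" for x y
      unfolding g_def by (simp add: inner_sum_left inner_sum_right inner_commute mult_ac)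
    then have "(transpose B *v x) \<bullet> y = (B *v x) \<bullet> y" for x y
      by (metis B dot_lmul_matrix vector_transpose_matrix transpose_transpose)
    then show ?thesis unfolding matrix_eq by (metis vector_eq_rdot)
  qed
  moreover have "v \<bullet> (B *v v) > 0" if v: "v \<noteq> 0" for v
  proof -
    have eq: "v \<bullet> (B *v v) = (\<Sum>e\<in>E. sqrt (e \<bullet> f e) * (e \<bullet> v)\<^sup>2)"
      unfolding B g_def by (simp add: inner_sum_right inner_commute power2_eq_square mult_ac)
    have "\<exists>e\<in>E. e \<bullet> v \<noteq> 0"
    proof (rule ccontr)
      assume "\<not> ?thesis"
      then have "orthogonal v e" if "e \<in> span E" for e
        using that by (intro orthogonal_to_span[of e E v]) (auto simp: orthogonal_def inner_commute)
      then have "orthogonal v v" using E(5) by auto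
      then show False using v by (simp add: orthogonal_def)
    qed
    then obtain e where e: "e \<in> E" "e \<bullet> v \<noteq> 0" by blast
    show ?thesis unfolding eq
      using E(1) e pos by (intro sum_pos2[of E e]) (auto simp: less_imp_le)
  qed
  ultimately show ?thesis by (auto simp: pos_def_matrix_def)
qed

text \<open>
  If \<open>B\<^sup>2 = C\<^sup>2\<close> and \<open>X = B - C\<close>, then \<open>BX + XC = 0\<close>, and an eigenvector of the symmetric matrix \<open>X\<close>
  can only have the eigenvalue \<open>0\<close>.
\<close>

lemma pos_def_sqrt_unique:
  fixes B C :: "real ^ 'n ^ 'n"
  assumes B: "pos_def_matrix B" and C: "pos_def_matrix C" and eq: "B ** B = C ** C"
  shows "B = C"
proof -
  define f where "f x = B *v x - C *v x" for x
  have f: "linear f" unfolding f_def by (intro linear_compose_sub) auto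
  have Badj: "(B *v x) \<bullet> y = x \<bullet> (B *v y)" and Cadj: "(C *v x) \<bullet> y = x \<bullet> (C *v y)" for x y
    using B C by (auto simp: pos_def_matrix_def matrix_vector_mult_self_adjoint)
  have adj: "f x \<bullet> y = x \<bullet> f y" for x y
    by (simp add: f_def inner_diff Badj Cadj)
  obtain E where E: "finite E" "pairwise orthogonal E" "\<And>e. e \<in> E \<Longrightarrow> norm e = 1"
    "\<And>e. e \<in> E \<Longrightarrow> f e = (e \<bullet> f e) *\<^sub>R e" "span E = UNIV"
    using self_adjoint_eigenbasis[OF f adj] by blast
  have fe: "f e = 0" if e: "e \<in> E" for e
  proof -
    define l where "l = e \<bullet> f e"
    have le: "f e = l *\<^sub>R e" using E(4)[OF e] by (simp add: l_def)
    have "e \<noteq> 0" using E(3)[OF e] by auto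
    then have "e \<bullet> (B *v e) > 0" "e \<bullet> (C *v e) > 0" using B C by (auto simp: pos_def_matrix_def)
    moreover have "(B *v e) \<bullet> (B *v e) = (C *v e) \<bullet> (C *v e)"
      using eq by (simp add: Badj Cadj matrix_vector_mul_assoc)
    then have "(B *v e) \<bullet> f e + f e \<bullet> (C *v e) = 0"
      by (simp add: f_def inner_diff inner_commute)
    then have "l * (e \<bullet> (B *v e) + e \<bullet> (C *v e)) = 0"
      unfolding le by (simp add: algebra_simps inner_commute)
    ultimately show ?thesis unfolding le by simp
  qed
  have "f x = 0" for x
    using linear_eq_on_span[of f "\<lambda>_. 0" E x] f fe E(5) by (auto simp: linear_zero)
  then show ?thesis unfolding matrix_eq by (simp add: f_def)
qed

lemma matrix_sqrt:
  assumes "pos_def_matrix A"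
  shows "pos_def_matrix (matrix_sqrt A)" "matrix_sqrt A ** matrix_sqrt A = A"
proof -
  have "\<exists>!B. pos_def_matrix B \<and> B ** B = A"
    using pos_def_sqrt_exists[OF assms] pos_def_sqrt_unique by metis
  from theI'[OF this] show "pos_def_matrix (matrix_sqrt A)" "matrix_sqrt A ** matrix_sqrt A = A"
    unfolding matrix_sqrt_def by auto
qed

lemma pos_def_invertible:
  assumes "pos_def_matrix A"
  shows "invertible A"
proof -
  have "inj ((*v) A)"
    using assms by (auto simp: matrix_left_invertible_injective[symmetric] matrix_left_invertible_ker pos_def_matrix_def)
  then show ?thesis by (simp add: invertible_left_inverse matrix_left_invertible_injective)
qed

lemma matrix_inv_cancel:
  fixes A :: "real ^ 'n ^ 'n"
  assumes "invertible A"
  shows "A *v (matrix_inv A *v v) = v" "matrix_inv A *v (A *v v) = v"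
proof -
  have "A ** matrix_inv A = mat 1 \<and> matrix_inv A ** A = mat 1"
    using assms unfolding matrix_inv_def invertible_def by (rule someI_ex)
  then show "A *v (matrix_inv A *v v) = v" "matrix_inv A *v (A *v v) = v"
    by (simp_all add: matrix_vector_mul_assoc)
qed

section \<open>Walls and orthogonal reflections\<close>

lemma span_axis_except:
  "span {axis k 1 |k. k \<noteq> i} = {v :: real ^ 'n. v $ i = 0}"
proof
  show "span {axis k 1 |k. k \<noteq> i} \<subseteq> {v :: real ^ 'n. v $ i = 0}"
    by (rule span_minimal) (auto simp: axis_def subspace_def)
  show "{v :: real ^ 'n. v $ i = 0} \<subseteq> span {axis k 1 |k. k \<noteq> i}"
  proof
    fix v :: "real ^ 'n" assume "v \<in> {v. v $ i = 0}"
    then have "v = (\<Sum>k\<in>UNIV - {i}. v $ k *\<^sub>R axis k 1)"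
      by (auto simp: vec_eq_iff axis_def if_distrib[where f="\<lambda>x. _ * x"] sum.delta' cong: if_cong)
    also have "\<dots> \<in> span {axis k 1 |k. k \<noteq> i}"
      by (intro span_sum span_scale span_base) auto
    finally show "v \<in> span {axis k 1 |k. k \<noteq> i}" .
  qed
qed

text \<open>A point \<open>x\<close> lies in the image iff \<open>(R x)_i = 0\<close>, and this
  coordinate is the inner product of \<open>x\<close> with \<open>R e_i\<close> by symmetry. So
  \<open>R e_i\<close> is a normal vector of the wall.\<close>

lemma image_matrix_inv_coordinate_hyperplane:
  fixes R :: "real ^ 'n ^ 'n"
  assumes "pos_def_matrix R"
  shows "(\<lambda>v. matrix_inv R *v v) ` span {axis k 1 |k. k \<noteq> i} = {x. (R *v axis i 1) \<bullet> x = 0}"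
proof -
  note inv = matrix_inv_cancel[OF pos_def_invertible[OF assms]]
  have "(R *v axis i 1) \<bullet> x = (R *v x) $ i" for x
    using assms by (simp add: pos_def_matrix_def matrix_vector_mult_self_adjoint inner_axis')
  then show ?thesis
    unfolding span_axis_except by (auto simp: inv image_iff) (metis inv)
qed

text \<open>The orthogonal complement of the hyperplane is the line of \<open>n\<close>. Splitting
  \<open>x\<close> along the two shows that the defining conditions leave only the usual
  formula.\<close>

lemma orth_reflection_hyperplane:
  fixes n :: "'a::euclidean_space"
  assumes n: "n \<bullet> n = 1"
  shows "orth_reflection {x. n \<bullet> x = 0} = (\<lambda>x. x - (2 * (n \<bullet> x)) *\<^sub>R n)"
  unfolding orth_reflection_def
proof (rule the_equality)
  let ?r = "\<lambda>x. x - (2 * (n \<bullet> x)) *\<^sub>R n"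
  let ?W = "{x. n \<bullet> x = 0}"
  have perp: "v = (n \<bullet> v) *\<^sub>R n" if "v \<in> ?W\<^sup>\<bottom>" for v
  proof -
    define u where "u = v - (n \<bullet> v) *\<^sub>R n"
    have "u \<in> ?W" using n by (simp add: u_def inner_diff)
    moreover from this have "u \<bullet> v = 0" using that by (auto simp: orthogonal_comp_def orthogonal_def)
    ultimately have "u \<bullet> u = 0" by (simp add: u_def inner_diff inner_commute)
    then show ?thesis by (simp add: u_def)
  qed
  have "?r v = - v" if "v \<in> ?W\<^sup>\<bottom>" for v
    using perp[OF that] by (simp add: scaleR_2 flip: scaleR_scaleR)
  moreover have "linear ?r"
    by (intro linearI) (simp_all add: inner_add algebra_simps)
  ultimately show "linear ?r \<and> (\<forall>v\<in>?W. ?r v = v) \<and> (\<forall>v\<in>?W\<^sup>\<bottom>. ?r v = - v)"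
    by simp
  fix r assume r: "linear r \<and> (\<forall>v\<in>?W. r v = v) \<and> (\<forall>v\<in>?W\<^sup>\<bottom>. r v = - v)"
  show "r = ?r"
  proof
    fix x
    define y where "y = x - (n \<bullet> x) *\<^sub>R n"
    have "y \<in> ?W" using n by (simp add: y_def inner_diff)
    moreover have "(n \<bullet> x) *\<^sub>R n \<in> ?W\<^sup>\<bottom>" by (auto simp: orthogonal_comp_def orthogonal_def inner_commute)
    ultimately have "r (y + (n \<bullet> x) *\<^sub>R n) = y - (n \<bullet> x) *\<^sub>R n"
      using r by (simp add: linear_add)
    then show "r x = ?r x" by (simp add: y_def scaleR_2 algebra_simps flip: scaleR_scaleR)
  qed
qed

section \<open>The critical point and the Hessian\<close>

definition upd_coord :: "real ^ 'n::finite \<Rightarrow> 'n \<Rightarrow> real \<Rightarrow> real ^ 'n" where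
  "upd_coord x i t = (\<chi> k. if k = i then t else x $ k)"

lemma upd_coord_nth [simp]: "upd_coord x i t $ k = (if k = i then t else x $ k)"
  by (simp add: upd_coord_def)

lemma upd_coord_same [simp]: "upd_coord x i (x $ i) = x"
  by (simp add: vec_eq_iff)

lemma has_derivative_upd_coord:
  "(upd_coord x i has_derivative (\<lambda>h. h *\<^sub>R axis i 1)) (at t)"
proof -
  have "((\<lambda>t. upd_coord x i t $ k) has_derivative (\<lambda>h. (h *\<^sub>R axis i 1) $ k)) (at t)" for k
    by (cases "k = i") (auto simp: axis_def)
  then show ?thesis
    unfolding has_derivative_componentwise_within[of "upd_coord x i"]
    by (auto simp: Basis_vec_def inner_axis simp del: upd_coord_nth)
qed

text \<open>The operator \<open>x_k * d/dx_k\<close> multiplies a monomial \<open>x^s\<close> by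
  \<open>s_k\<close>. Derivatives therefore remain inventories with weights changed by factors
  \<open>s_k\<close>, which is why the weights here are arbitrary.\<close>

lemma real_inventory_has_derivative:
  fixes x :: "real ^ 'n::finite"
  assumes x: "\<And>k. x $ k \<noteq> 0"
  shows "(real_inventory S w has_derivative
    (\<lambda>v. \<Sum>k\<in>UNIV. real_inventory S (\<lambda>s. w s * of_int (s $ k)) x / x $ k * v $ k)) (at x)"
proof -
  let ?m = "\<lambda>s x. \<Prod>k\<in>UNIV. x $ k powi (s $ k)"
  have m: "(?m s has_derivative (\<lambda>v. \<Sum>k\<in>UNIV. of_int (s $ k) * ?m s x / x $ k * v $ k)) (at x)"
    for s :: "int ^ 'n"
  proof -
    have "(?m s has_derivative (\<lambda>v. \<Sum>k\<in>UNIV. (v $ k * (of_int (s $ k) * x $ k powi (s $ k - 1))) *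
        (\<Prod>j\<in>UNIV - {k}. x $ j powi (s $ j)))) (at x)"
      using x by (intro has_derivative_prod has_derivative_power_int bounded_linear_imp_has_derivative
          bounded_linear_vec_nth) auto
    moreover have "(v $ k * (of_int (s $ k) * x $ k powi (s $ k - 1))) *
        (\<Prod>j\<in>UNIV - {k}. x $ j powi (s $ j)) = of_int (s $ k) * ?m s x / x $ k * v $ k" for v k
      using x[of k] by (subst (2) prod.remove[of _ k]) (auto simp: power_int_diff)
    ultimately show ?thesis by simp
  qed
  have "(real_inventory S w has_derivative
      (\<lambda>v. \<Sum>s\<in>S. w s * (\<Sum>k\<in>UNIV. of_int (s $ k) * ?m s x / x $ k * v $ k))) (at x)"
    unfolding real_inventory_def[abs_def] inventory_def
    by (intro has_derivative_sum has_derivative_mult_right m)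
  moreover have "(\<Sum>s\<in>S. w s * (\<Sum>k\<in>UNIV. of_int (s $ k) * ?m s x / x $ k * v $ k)) =
      (\<Sum>k\<in>UNIV. real_inventory S (\<lambda>s. w s * of_int (s $ k)) x / x $ k * v $ k)" for v
    unfolding real_inventory_def inventory_def sum_distrib_left sum_distrib_right sum_divide_distrib
    by (subst sum.swap) (simp add: mult_ac)
  ultimately show ?thesis by simp
qed

lemma DERIV_real_inventory_coord:
  fixes x :: "real ^ 'n::finite"
  assumes x: "\<And>k. x $ k \<noteq> 0"
  shows "((\<lambda>t. real_inventory S w (upd_coord x i t)) has_real_derivative
    real_inventory S (\<lambda>s. w s * of_int (s $ i)) x / x $ i) (at (x $ i))"
proof -
  have d: "((\<lambda>t. real_inventory S w (upd_coord x i t)) has_derivative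
      (\<lambda>h. \<Sum>k\<in>UNIV. real_inventory S (\<lambda>s. w s * of_int (s $ k)) x / x $ k * (h *\<^sub>R axis i 1) $ k)) (at (x $ i))"
    by (rule has_derivative_compose[OF has_derivative_upd_coord])
      (simp only: upd_coord_same real_inventory_has_derivative[OF x])
  have eq: "(\<Sum>k\<in>UNIV. real_inventory S (\<lambda>s. w s * of_int (s $ k)) x / x $ k * (h *\<^sub>R axis i 1) $ k)
      = (\<Sum>k\<in>UNIV. if k = i then real_inventory S (\<lambda>s. w s * of_int (s $ i)) x / x $ i * h else 0)" for h
    by (intro sum.cong) (auto simp: axis_def)
  show ?thesis
    unfolding has_field_derivative_def by (rule has_derivative_eq_rhs[OF d], rule ext, subst eq) simp
qed

lemma partial_deriv_upd_coord: "partial_deriv i f x = deriv (\<lambda>t. f (upd_coord x i t)) (x $ i)"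
  by (simp add: partial_deriv_def upd_coord_def)

lemma partial_deriv_real_inventory:
  assumes "\<And>k. x $ k \<noteq> 0"
  shows "partial_deriv i (real_inventory S w) x = real_inventory S (\<lambda>s. w s * of_int (s $ i)) x / x $ i"
  unfolding partial_deriv_upd_coord
  by (rule DERIV_imp_deriv) (rule DERIV_real_inventory_coord[OF assms])

text \<open>Differentiating the factor \<open>1 / x_j\<close> contributes only when
  \<open>i = j\<close>, and then with the first moment as a factor, which is zero by
  \<open>crit\<close>. Hence one formula serves both cases.\<close>

lemma second_partial_deriv_real_inventory:
  assumes x: "\<And>k. x $ k \<noteq> 0"
    and crit: "real_inventory S (\<lambda>s. w s * of_int (s $ j)) x = 0"
  shows "partial_deriv i (partial_deriv j (real_inventory S w)) x =
    real_inventory S (\<lambda>s. w s * of_int (s $ j) * of_int (s $ i)) x / (x $ i * x $ j)"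
proof -
  let ?F = "real_inventory S (\<lambda>s. w s * of_int (s $ j))"
  have "eventually (\<lambda>t::real. t \<noteq> 0) (nhds (x $ i))"
    using x by (intro t1_space_nhds) auto
  then have "eventually (\<lambda>t. partial_deriv j (real_inventory S w) (upd_coord x i t) =
      ?F (upd_coord x i t) / upd_coord x i t $ j) (nhds (x $ i))"
    by eventually_elim (rule partial_deriv_real_inventory, use x in auto)
  then have "partial_deriv i (partial_deriv j (real_inventory S w)) x =
      deriv (\<lambda>t. ?F (upd_coord x i t) / upd_coord x i t $ j) (x $ i)"
    unfolding partial_deriv_upd_coord[of i] by (rule deriv_cong_ev) simp
  also have "((\<lambda>t. ?F (upd_coord x i t) / upd_coord x i t $ j) has_real_derivative
      ((real_inventory S (\<lambda>s. w s * of_int (s $ j) * of_int (s $ i)) x / x $ i) * upd_coord x i (x $ i) $ j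
       - ?F (upd_coord x i (x $ i)) * (if j = i then 1 else 0)) /
       (upd_coord x i (x $ i) $ j * upd_coord x i (x $ i) $ j)) (at (x $ i))"
    by (rule DERIV_divide[OF DERIV_real_inventory_coord[OF x]]) (use x in auto)
  then have "deriv (\<lambda>t. ?F (upd_coord x i t) / upd_coord x i t $ j) (x $ i) =
      real_inventory S (\<lambda>s. w s * of_int (s $ j) * of_int (s $ i)) x / (x $ i * x $ j)"
    using crit x by (subst DERIV_imp_deriv) (auto simp: upd_coord_same simp del: upd_coord_nth)
  finally show ?thesis .
qed

text \<open>Passage to logarithmic coordinates, in which the inventory becomes a sum of exponentials
  of linear forms.\<close>

lemma step_monomial_exp:
  "(\<Prod>k\<in>UNIV. exp (y $ k) powi (s $ k)) = exp (step_vec s \<bullet> y)"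
  for s :: "int ^ 'n::finite" and y :: "real ^ 'n::finite"
  by (simp add: exp_power_int step_vec_def inner_vec_def exp_sum)

lemma real_inventory_exp:
  fixes y :: "real ^ 'n::finite"
  shows "real_inventory S v (\<chi> k. exp (y $ k)) = (\<Sum>s\<in>S. v s * exp (step_vec s \<bullet> y))"
  by (simp add: real_inventory_def inventory_def step_monomial_exp)

lemma exp_ln_vec: "(\<And>k. x $ k > 0) \<Longrightarrow> (\<chi> k. exp ((\<chi> k. ln (x $ k)) $ k)) = x"
  for x :: "real ^ 'n::finite"
  by (intro vec_eq_iff[THEN iffD2] allI) simp

section \<open>The critical point and second moments of a step model\<close>

locale step_model =
  fixes S :: "(int ^ 'n::{finite,linorder}) set" and w :: "int ^ 'n::{finite,linorder} \<Rightarrow> real"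
  assumes steps: "S \<subseteq> {s. \<forall>i. s $ i \<in> {-1, 0, 1}}"
    and w_pos: "s \<in> S \<Longrightarrow> w s > 0"
    and not_half_space: "\<nexists>u :: real ^ 'n::{finite,linorder}. u \<noteq> 0 \<and> step_vec ` S \<subseteq> {y. u \<bullet> y \<ge> 0}"
begin

lemma finite_S: "finite S"
proof (rule finite_subset[OF steps])
  have "s \<in> vec_lambda ` (UNIV \<rightarrow>\<^sub>E {-1, 0, 1})" if "\<forall>i. s $ i \<in> {-1, 0, 1}" for s :: "int ^ 'n::{finite,linorder}"
    using that by (intro image_eqI[of _ _ "vec_nth s"]) auto
  moreover have "finite (vec_lambda ` ((UNIV :: 'n set) \<rightarrow>\<^sub>E {-1, 0, 1 :: int}))"
    by (intro finite_imageI finite_PiE) auto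
  ultimately show "finite {s :: int ^ 'n::{finite,linorder}. \<forall>i. s $ i \<in> {-1, 0, 1}}"
    by (elim finite_subset[rotated]) auto
qed

lemma exists_positive_step:
  assumes "u \<noteq> 0"
  obtains s where "s \<in> S" "step_vec s \<bullet> u > 0"
proof -
  have "\<not> step_vec ` S \<subseteq> {y. (- u) \<bullet> y \<ge> 0}"
    using not_half_space assms by (metis neg_equal_0_iff_equal)
  then obtain s where "s \<in> S" "\<not> (- u) \<bullet> step_vec s \<ge> 0" by blast
  then show ?thesis using that by (simp add: inner_commute)
qed

text \<open>The half-space hypothesis in the directions \<open>e_i\<close> and \<open>- e_i\<close>.
  It makes \<open>A_i\<close> and \<open>C_i\<close> nonempty sums, hence positive on the positive
  orthant.\<close>

lemma exists_step_coord:
  assumes "e = 1 \<or> e = -1"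
  obtains s where "s \<in> S" "s $ i = e"
proof -
  have "axis i (of_int e) \<noteq> (0 :: real ^ 'n::{finite,linorder})" using assms by (auto simp: axis_eq_0_iff)
  then obtain s where s: "s \<in> S" "step_vec s \<bullet> axis i (of_int e) > 0" using exists_positive_step by blast
  then have "real_of_int (s $ i * e) > 0" by (simp add: step_vec_def inner_axis)
  moreover have "s $ i \<in> {-1, 0, 1}" using s steps by auto
  ultimately have "s $ i = e" using assms by auto
  then show ?thesis using that s by blast
qed

text \<open>Coercivity: from \<open>exp t \<ge> max 0 t\<close> the sum \<open>f\<close> dominates
  the positively homogeneous \<open>g\<close>, whose minimum on the unit sphere is positive because
  every nonzero direction has a step with positive inner product.\<close>

lemma minimizer_exists:
  obtains y :: "real ^ 'n::{finite,linorder}" where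
    "\<And>z. (\<Sum>s\<in>S. w s * exp (step_vec s \<bullet> y)) \<le> (\<Sum>s\<in>S. w s * exp (step_vec s \<bullet> z))"
proof -
  define f where "f y = (\<Sum>s\<in>S. w s * exp (step_vec s \<bullet> y))" for y :: "real ^ 'n::{finite,linorder}"
  define g where "g y = (\<Sum>s\<in>S. w s * max 0 (step_vec s \<bullet> y))" for y :: "real ^ 'n::{finite,linorder}"
  have "continuous_on (sphere 0 1) g" unfolding g_def by (intro continuous_intros)
  moreover have "sphere 0 1 \<noteq> ({} :: (real ^ 'n::{finite,linorder}) set)" by simp
  ultimately obtain u where u: "u \<in> sphere 0 1" "\<And>v. v \<in> sphere 0 1 \<Longrightarrow> g u \<le> g v"
    using continuous_attains_inf[OF compact_sphere] by metis
  have "u \<noteq> 0" using u by auto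
  then obtain s where "s \<in> S" "step_vec s \<bullet> u > 0" by (rule exists_positive_step)
  then have gu: "g u > 0"
    unfolding g_def using finite_S w_pos by (intro sum_pos2[of S s]) (auto simp: less_imp_le)
  have fg: "g u * norm y \<le> f y" for y
  proof -
    have "g u * norm y \<le> g y"
    proof (cases "y = 0")
      case False
      then have "g u \<le> g (y /\<^sub>R norm y)" by (intro u) simp
      also have "\<dots> = g y / norm y"
      proof -
        have "max 0 (step_vec s \<bullet> (y /\<^sub>R norm y)) = max 0 (step_vec s \<bullet> y) / norm y" for s
          by (simp add: max_mult_distrib_left divide_inverse_commute)
        then show ?thesis by (simp add: g_def sum_divide_distrib)
      qed
      finally show ?thesis using False by (simp add: field_simps)
    qed (simp add: g_def)
    also have "\<dots> \<le> f y" unfolding f_def g_def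
    proof (rule sum_mono)
      fix s assume "s \<in> S"
      have "max 0 (step_vec s \<bullet> y) \<le> exp (step_vec s \<bullet> y)"
        using exp_ge_add_one_self[of "step_vec s \<bullet> y"] exp_ge_zero[of "step_vec s \<bullet> y"]
        unfolding max.bounded_iff by linarith
      then show "w s * max 0 (step_vec s \<bullet> y) \<le> w s * exp (step_vec s \<bullet> y)"
        using w_pos[OF \<open>s \<in> S\<close>] by (intro mult_left_mono) auto
    qed
    finally show ?thesis .
  qed
  \<comment> \<open>Outside the ball of radius \<open>R\<close> the bound \<open>fg\<close> gives
    \<open>f z \<ge> f 0\<close>, so a minimum over the ball is global.\<close>
  define R where "R = f 0 / g u"
  have "f 0 \<ge> 0" using fg[of 0] by simp
  then have R: "R \<ge> 0" using gu by (simp add: R_def)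
  have "continuous_on (cball 0 R) f" unfolding f_def by (intro continuous_intros)
  then obtain y where y: "y \<in> cball 0 R" "\<And>z. z \<in> cball 0 R \<Longrightarrow> f y \<le> f z"
    using continuous_attains_inf[OF compact_cball, of 0 R f] R by auto
  have "f y \<le> f z" for z
  proof (cases "z \<in> cball 0 R")
    case False
    then have "f 0 \<le> g u * norm z" using gu by (simp add: R_def field_simps)
    also have "\<dots> \<le> f z" by (rule fg)
    finally show ?thesis using y(2)[of 0] R by simp
  qed (rule y)
  then show ?thesis unfolding f_def by (rule that)
qed

definition "critical x \<longleftrightarrow> (\<forall>i. x $ i > 0) \<and> (\<forall>i. real_inventory S (\<lambda>s. w s * of_int (s $ i)) x = 0)"

lemma critical_exists: "\<exists>x. critical x"
proof -
  obtain y :: "real ^ 'n::{finite,linorder}" where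
    y: "\<And>z. (\<Sum>s\<in>S. w s * exp (step_vec s \<bullet> y)) \<le> (\<Sum>s\<in>S. w s * exp (step_vec s \<bullet> z))"
    using minimizer_exists by blast
  define x where "x = (\<chi> k. exp (y $ k))"
  have pos: "x $ k > 0" for k by (simp add: x_def)
  then have nz: "x $ k \<noteq> 0" for k by (metis less_irrefl)
  have min: "real_inventory S w x \<le> real_inventory S w z" if "\<And>k. z $ k > 0" for z
    using y[of "\<chi> k. ln (z $ k)"] real_inventory_exp[of S w y] real_inventory_exp[of S w "\<chi> k. ln (z $ k)"]
      exp_ln_vec[OF that] by (simp add: x_def)
  have "real_inventory S (\<lambda>s. w s * of_int (s $ i)) x / x $ i = 0" for i
  proof (rule DERIV_local_min[OF DERIV_real_inventory_coord[OF nz, of S w i] pos[of i]], intro allI impI)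
    \<comment> \<open>The window of radius \<open>x_i\<close> around \<open>x_i\<close> keeps
      \<open>t\<close> positive, so minimality on the positive orthant applies.\<close>
    fix t assume "\<bar>x $ i - t\<bar> < x $ i"
    then have "t > 0" by linarith
    then show "real_inventory S w (upd_coord x i (x $ i)) \<le> real_inventory S w (upd_coord x i t)"
      using pos by (auto intro!: min)
  qed
  then have "critical x" using pos nz by (auto simp: critical_def)
  then show ?thesis ..
qed

text \<open>Strict convexity in logarithmic coordinates: the two gradients paired with
  \<open>u = y - y'\<close> give a vanishing sum of nonnegative terms, so \<open>u\<close> is
  orthogonal to every step, which the half-space hypothesis excludes unless
  \<open>u = 0\<close>.\<close>

lemma critical_unique:
  assumes "critical x" "critical x'"
  shows "x = x'"
proof -
  define y where "y = (\<chi> k. ln (x $ k))"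
  define y' where "y' = (\<chi> k. ln (x' $ k))"
  have x: "x = (\<chi> k. exp (y $ k))" "x' = (\<chi> k. exp (y' $ k))"
    using assms by (simp_all add: y_def y'_def vec_eq_iff critical_def)
  define u where "u = y - y'"
  have zero: "(\<Sum>s\<in>S. w s * (step_vec s \<bullet> u) * exp (step_vec s \<bullet> z)) = 0"
    if "critical (\<chi> k. exp (z $ k))" for z
  proof -
    have "(\<Sum>s\<in>S. w s * (step_vec s \<bullet> u) * exp (step_vec s \<bullet> z)) =
        (\<Sum>i\<in>UNIV. u $ i * (\<Sum>s\<in>S. w s * of_int (s $ i) * exp (step_vec s \<bullet> z)))"
      unfolding inner_vec_def[of _ u] sum_distrib_left sum_distrib_right
      by (subst sum.swap) (simp add: step_vec_def mult_ac)
    then show ?thesis using that by (simp add: critical_def flip: real_inventory_exp)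
  qed
  have "(\<Sum>s\<in>S. w s * ((step_vec s \<bullet> u) * (exp (step_vec s \<bullet> y) - exp (step_vec s \<bullet> y')))) = 0"
    using zero[of y] zero[of y'] assms unfolding x by (simp add: algebra_simps sum_subtractf)
  moreover have nonneg: "(step_vec s \<bullet> u) * (exp (step_vec s \<bullet> y) - exp (step_vec s \<bullet> y')) \<ge> 0" for s
    unfolding u_def inner_diff zero_le_mult_iff by auto
  ultimately have "\<forall>s\<in>S. w s * ((step_vec s \<bullet> u) * (exp (step_vec s \<bullet> y) - exp (step_vec s \<bullet> y'))) = 0"
    using w_pos finite_S by (subst (asm) sum_nonneg_eq_0_iff) (auto simp: less_imp_le)
  then have "step_vec s \<bullet> u = 0" if "s \<in> S" for s
    using that w_pos[OF that] by (auto simp: u_def inner_diff)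
  then have "u = 0" using exists_positive_step by (metis less_irrefl)
  then show ?thesis using x by (simp add: u_def)
qed

definition "cp = crit_point S w"

lemma critical_cp: "critical cp"
proof -
  have "(\<forall>i. x $ i > 0) \<and> (\<forall>i. partial_deriv i (real_inventory S w) x = 0) \<longleftrightarrow> critical x" for x
  proof (cases "\<forall>i. x $ i > 0")
    case True
    then have "x $ i \<noteq> 0" for i by (metis less_irrefl)
    then show ?thesis using partial_deriv_real_inventory[of x _ S w] by (auto simp: critical_def)
  qed (auto simp: critical_def)
  then have "cp = (THE x. critical x)" by (simp add: cp_def crit_point_def)
  moreover have "\<exists>!x. critical x" using critical_exists critical_unique by blast
  ultimately show ?thesis using theI' by metis
qed

lemma cp_pos: "cp $ i > 0"
  using critical_cp by (simp add: critical_def)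

lemma cp_nonzero: "cp $ i \<noteq> 0"
  using cp_pos[of i] by simp

lemma first_moment_zero: "real_inventory S (\<lambda>s. w s * of_int (s $ i)) cp = 0"
  using critical_cp by (simp add: critical_def)

text \<open>The Hessian of the inventory in logarithmic coordinates at the critical point, that is,
  the second moments of the steps under the masses \<open>w(s) * x_0^s\<close>.\<close>

definition moment :: "'n \<Rightarrow> 'n \<Rightarrow> real" where
  "moment i j = real_inventory S (\<lambda>s. w s * of_int (s $ i) * of_int (s $ j)) cp"

lemma moment_commute: "moment i j = moment j i"
  by (simp add: moment_def mult_ac)

lemma hess_eq: "hess S w i j = moment i j / (cp $ i * cp $ j)"
  using second_partial_deriv_real_inventory[OF cp_nonzero first_moment_zero, of i j]
  by (simp add: hess_def cp_def[symmetric] moment_def mult_ac)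

text \<open>After exchanging the sums, the quadratic form is the sum of
  \<open>w(s) * x_0^s * <s, v>^2\<close>, and some step is not orthogonal to
  \<open>v\<close>.\<close>

lemma moment_pos_def:
  fixes v :: "real ^ 'n::{finite,linorder}"
  assumes "v \<noteq> 0"
  shows "(\<Sum>i\<in>UNIV. \<Sum>j\<in>UNIV. v $ i * moment i j * v $ j) > 0"
proof -
  let ?m = "\<lambda>s. \<Prod>k\<in>UNIV. cp $ k powi (s $ k)"
  have "(\<Sum>i\<in>UNIV. \<Sum>j\<in>UNIV. v $ i * moment i j * v $ j) =
      (\<Sum>i\<in>UNIV. \<Sum>j\<in>UNIV. \<Sum>s\<in>S. (w s * ?m s) * ((of_int (s $ i) * v $ i) * (of_int (s $ j) * v $ j)))"
    unfolding moment_def real_inventory_def inventory_def sum_distrib_left sum_distrib_right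
    by (simp add: mult_ac)
  also have "\<dots> = (\<Sum>i\<in>UNIV. \<Sum>s\<in>S. \<Sum>j\<in>UNIV. (w s * ?m s) * ((of_int (s $ i) * v $ i) * (of_int (s $ j) * v $ j)))"
    by (intro sum.cong refl sum.swap)
  also have "\<dots> = (\<Sum>s\<in>S. \<Sum>i\<in>UNIV. \<Sum>j\<in>UNIV. (w s * ?m s) * ((of_int (s $ i) * v $ i) * (of_int (s $ j) * v $ j)))"
    by (rule sum.swap)
  also have "\<dots> = (\<Sum>s\<in>S. (w s * ?m s) * (step_vec s \<bullet> v)\<^sup>2)"
  proof -
    have "(step_vec s \<bullet> v)\<^sup>2 = (\<Sum>i\<in>UNIV. \<Sum>j\<in>UNIV. (of_int (s $ i) * v $ i) * (of_int (s $ j) * v $ j))" for s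
      by (simp only: step_vec_def inner_vec_def power2_eq_square sum_product vec_lambda_beta inner_real_def)
    then show ?thesis by (simp only: sum_distrib_left)
  qed
  also have "\<dots> > 0"
  proof -
    obtain s where s: "s \<in> S" "step_vec s \<bullet> v > 0" using exists_positive_step[OF assms] .
    have m: "?m s > 0" for s by (intro prod_pos) (simp add: cp_pos)
    show ?thesis
      using s finite_S w_pos m by (intro sum_pos2[of S s]) (auto simp: less_imp_le mult_nonneg_nonneg)
  qed
  finally show ?thesis .
qed

lemma moment_diag_pos: "moment i i > 0"
proof -
  have "(\<Sum>k\<in>UNIV. \<Sum>j\<in>UNIV. axis i 1 $ k * moment k j * axis i 1 $ j) =
      (\<Sum>k\<in>UNIV. \<Sum>j\<in>UNIV. if j = i then (if k = i then moment i i else 0) else 0)"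
    by (intro sum.cong refl) (auto simp: axis_def)
  then show ?thesis using moment_pos_def[of "axis i 1"] by (simp add: axis_eq_0_iff)
qed

text \<open>The coordinates of the critical point cancel in the normalization, so
  \<open>Delta\<close> is the correlation matrix of the moments and has unit diagonal.\<close>

lemma Delta_eq: "Delta S w $ i $ j = moment i j / (sqrt (moment i i) * sqrt (moment j j))"
proof -
  have "hess S w i i * hess S w j j = (moment i i * moment j j) / (cp $ i * cp $ j)\<^sup>2"
    by (simp add: hess_eq power2_eq_square mult_ac)
  then have "sqrt (hess S w i i * hess S w j j) = sqrt (moment i i) * sqrt (moment j j) / (cp $ i * cp $ j)"
    using cp_pos[of i] cp_pos[of j] by (simp add: real_sqrt_divide real_sqrt_mult)
  then show ?thesis
    using cp_nonzero by (simp add: Delta_def hess_eq)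
qed

lemma Delta_diag: "Delta S w $ i $ i = 1"
  using moment_diag_pos[of i] by (simp add: Delta_eq)

lemma pos_def_Delta: "pos_def_matrix (Delta S w)"
  unfolding pos_def_matrix_def
proof (intro conjI allI impI)
  show "transpose (Delta S w) = Delta S w"
    by (simp add: vec_eq_iff transpose_def Delta_eq moment_commute mult.commute)
  fix v :: "real ^ 'n::{finite,linorder}" assume v: "v \<noteq> 0"
  define u where "u = (\<chi> i. v $ i / sqrt (moment i i))"
  have sq: "sqrt (moment i i) \<noteq> 0" for i using moment_diag_pos[of i] by simp
  have "u \<noteq> 0" using v sq by (auto simp: u_def vec_eq_iff)
  have "v \<bullet> (Delta S w *v v) = (\<Sum>i\<in>UNIV. \<Sum>j\<in>UNIV. u $ i * moment i j * u $ j)"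
    by (simp add: inner_vec_def matrix_vector_mult_def Delta_eq u_def sum_distrib_left mult_ac)
  then show "v \<bullet> (Delta S w *v v) > 0" using moment_pos_def[OF \<open>u \<noteq> 0\<close>] by simp
qed

end

section \<open>The tangent representation of the combinatorial group\<close>

lemma mult_BijGroup_UNIV:
  "f \<in> carrier (BijGroup UNIV) \<Longrightarrow> g \<in> carrier (BijGroup UNIV) \<Longrightarrow> f \<otimes>\<^bsub>BijGroup UNIV\<^esub> g = f \<circ> g"
  by (auto simp: BijGroup_def compose_def o_def)

context step_model
begin

definition cofactor :: "'n \<Rightarrow> int \<Rightarrow> real ^ 'n::{finite,linorder} \<Rightarrow> real" where
  "cofactor j e x = inv_coeff (\<lambda>a. a) S w j e (\<lambda>k. x $ k)"

definition real_phi :: "'n \<Rightarrow> real ^ 'n::{finite,linorder} \<Rightarrow> real ^ 'n::{finite,linorder}" where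
  "real_phi j x = upd_coord x j (inverse (x $ j) * (cofactor j (-1) x / cofactor j 1 x))"

lemma germ_cofactor: "germ cp (inv_coeff const_rf S w j e var_rf) (cofactor j e)"
  unfolding inv_coeff_def cofactor_def[abs_def]
  by (intro germ_sum germ_mult germ_const germ_prod germ_power_int germ_var cp_nonzero)

lemma cofactor_pos:
  assumes x: "\<And>k. x $ k > 0" and e: "e = 1 \<or> e = -1"
  shows "cofactor j e x > 0"
proof -
  obtain s where "s \<in> S" "s $ j = e" using exists_step_coord[OF e] .
  then show ?thesis
    unfolding cofactor_def inv_coeff_def using finite_S w_pos x
    by (intro sum_pos mult_pos_pos prod_pos) auto
qed

lemma cofactor_upd_coord: "cofactor j e (upd_coord x j t) = cofactor j e x"
  by (simp add: cofactor_def inv_coeff_def)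

text \<open>The factor \<open>s_j\<close> is 1, 0 and -1 on the parts belonging to
  \<open>A_j\<close>, \<open>B_j\<close> and \<open>C_j\<close>; in the second moment its square
  removes the sign.\<close>

lemma first_moment_decomp:
  "real_inventory S (\<lambda>s. w s * of_int (s $ j)) x = x $ j * cofactor j 1 x - inverse (x $ j) * cofactor j (-1) x"
  unfolding real_inventory_def
  by (subst inventory_decomp[OF steps, of _ _ _ j])
    (simp add: cofactor_def inv_coeff_def sum_negf cong: sum.cong_simp)

lemma second_moment_decomp:
  "moment j j = cp $ j * cofactor j 1 cp + inverse (cp $ j) * cofactor j (-1) cp"
  unfolding real_inventory_def moment_def
  by (subst inventory_decomp[OF steps, of _ _ _ j])
    (simp add: cofactor_def inv_coeff_def cong: sum.cong_simp)

lemma cofactor_cp_eq: "inverse (cp $ j) * cofactor j (-1) cp = cp $ j * cofactor j 1 cp"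
  using first_moment_decomp[of j cp] first_moment_zero[of j] by simp

text \<open>At the critical point the two terms of the second moment are equal. This is the origin
  of the 2 in the reflection formula.\<close>

lemma cofactor_cp_moment: "cofactor j 1 cp = moment j j / (2 * cp $ j)"
  using second_moment_decomp[of j] cofactor_cp_eq[of j] cp_nonzero[of j] by simp

lemma cofactor_cp_nonzero: "e = 1 \<or> e = -1 \<Longrightarrow> cofactor j e cp \<noteq> 0"
  using cofactor_pos[of cp e j] cp_pos by force

text \<open>The map exchanges the two solutions \<open>t\<close> of
  \<open>t A_j + C_j / t = const\<close>; at the critical point they coincide.\<close>

lemma real_phi_cp: "real_phi j cp = cp"
proof -
  have "inverse (cp $ j) * (cofactor j (-1) cp / cofactor j 1 cp) = cp $ j"
    using cofactor_cp_eq[of j] cofactor_cp_nonzero[of 1 j] by (simp add: field_simps)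
  then show ?thesis by (simp add: real_phi_def)
qed

lemma germ_phi: "germ cp (phi S w j i) (\<lambda>x. real_phi j x $ i)"
proof (cases "i = j")
  case True
  have "germ cp (inverse (var_rf j) * (inv_coeff const_rf S w j (-1) var_rf / inv_coeff const_rf S w j 1 var_rf))
      (\<lambda>x. inverse (x $ j) * (cofactor j (-1) x / cofactor j 1 x))"
    by (intro germ_mult germ_inverse germ_divide germ_var germ_cofactor cp_nonzero cofactor_cp_nonzero) simp
  then show ?thesis using True by (simp add: phi_def real_phi_def)
next
  case False
  then show ?thesis using germ_var[of cp i] by (simp add: phi_def real_phi_def)
qed

lemma fixes_germ_phi: "fixes_germ cp (phi S w j)"
  by (rule fixes_germI[of _ _ "real_phi j"]) (rule germ_phi real_phi_cp)+

lemma eventually_positive: "eventually (\<lambda>x. \<forall>k. x $ k > 0) (nhds cp)"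
proof -
  have "eventually (\<lambda>x. x $ k > 0) (nhds cp)" for k
    by (rule order_tendstoD(1)[OF tendsto_vec_nth[OF filterlim_ident] cp_pos])
  then show ?thesis by (simp add: eventually_all_finite)
qed

lemma real_phi_involution: "eventually (\<lambda>x. real_phi j (real_phi j x) = x) (nhds cp)"
  using eventually_positive
proof eventually_elim
  case (elim x)
  then have "x $ j \<noteq> 0" "cofactor j 1 x \<noteq> 0" "cofactor j (-1) x \<noteq> 0"
    using cofactor_pos[of x 1 j] cofactor_pos[of x "-1" j] by (metis less_irrefl)+
  then show ?case by (simp add: real_phi_def cofactor_upd_coord vec_eq_iff inverse_eq_divide)
qed

lemma phi_phi: "rat_comp (phi S w j) (phi S w j) = var_rf"
proof
  fix i
  have "germ cp (rat_comp (phi S w j) (phi S w j) i) (\<lambda>x. real_phi j (real_phi j x) $ i)"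
    by (rule germ_rat_comp) (rule germ_phi real_phi_cp)+
  then have "germ cp (rat_comp (phi S w j) (phi S w j) i) (\<lambda>x. x $ i)"
    by (rule germ_cong) (rule eventually_mono[OF real_phi_involution[of j]], simp)
  then show "rat_comp (phi S w j) (phi S w j) i = var_rf i"
    using germ_inject[OF cp_nonzero] germ_var by blast
qed

text \<open>If \<open>p\<close> vanished along \<open>phi_j\<close>, it would vanish at
  \<open>real_phi j x\<close> for all \<open>x\<close> near \<open>cp\<close>. Inserting
  \<open>real_phi j x\<close> for \<open>x\<close> and using the involution makes \<open>p\<close>
  vanish near \<open>cp\<close>.\<close>

lemma dominant_phi: "dominant (phi S w j)"
  unfolding dominant_def
proof (intro allI impI notI)
  fix p assume "p \<noteq> 0" "mpoly_eval const_rf (phi S w j) p = 0"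
  then have "germ cp 0 (\<lambda>x. rpoly p (\<chi> i. real_phi j x $ i))"
    using germ_mpoly_eval[of cp "phi S w j" "\<lambda>i x. real_phi j x $ i" p] germ_phi by simp
  then have ev: "eventually (\<lambda>x. rpoly p (real_phi j x) = 0) (nhds cp)"
    using germ_unique[OF _ germ_zero] by simp
  have "(real_phi j \<longlongrightarrow> cp) (nhds cp)"
    using tendsto_tuple_germs[of cp "phi S w j" "\<lambda>i x. real_phi j x $ i"] by (simp add: germ_phi real_phi_cp)
  then have "eventually (\<lambda>x. rpoly p (real_phi j (real_phi j x)) = 0) (nhds cp)"
    using ev unfolding filterlim_iff by blast
  with real_phi_involution[of j] have "eventually (\<lambda>x. rpoly p x = 0) (nhds cp)"
    by eventually_elim simp
  then show False using rpoly_eventually_zero[OF cp_nonzero] \<open>p \<noteq> 0\<close> by blast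
qed

lemma phi_in_carrier: "phi S w j \<in> carrier birational_group"
  using phi_phi dominant_phi by (auto simp: birational_group_def birational_def)

lemma carrier_comb_group: "carrier (comb_group S w) = generate birational_group (range (phi S w))"
  using phi_in_carrier by (simp add: comb_group_def carrier_subgroup_generated Int_absorb1 image_subset_iff)

lemma fixes_germ_comb_group:
  assumes "g \<in> carrier (comb_group S w)"
  shows "fixes_germ cp g"
  using assms unfolding carrier_comb_group
proof induction
  case one
  then show ?case by (simp add: birational_group_def fixes_germ_var)
next
  case (incl h)
  then show ?case using fixes_germ_phi by auto
next
  \<comment> \<open>Inverses enter \<open>generate\<close> only for generators, and each generator
    is its own inverse.\<close>
  case (inv h)
  then obtain j where j: "h = phi S w j" by auto
  have "inv\<^bsub>birational_group\<^esub> h = h"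
    using phi_in_carrier phi_phi unfolding j
    by (intro group.inv_equality[OF group_birational_group]) (auto simp: birational_group_def)
  then show ?case using fixes_germ_phi j by simp
next
  case (eng h1 h2)
  then show ?case by (simp add: birational_group_def fixes_germ_rat_comp)
qed

lemma real_phi_has_derivative:
  "(real_phi j has_derivative
    (\<lambda>v. v - (2 * cp $ j / moment j j * (\<Sum>k\<in>UNIV. moment j k * v $ k / cp $ k)) *\<^sub>R axis j 1)) (at cp)"
proof -
  (* phi_j subtracts F / A_j from x_j, where F = x_j * (d chi / d x_j) vanishes at cp. *)
  let ?F = "real_inventory S (\<lambda>s. w s * of_int (s $ j))"
  let ?F' = "\<lambda>v. \<Sum>k\<in>UNIV. moment j k / cp $ k * v $ k"
  define A where "A = cofactor j 1"
  have A0: "A cp = moment j j / (2 * cp $ j)" "A cp \<noteq> 0"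
    unfolding A_def by (rule cofactor_cp_moment, rule cofactor_cp_nonzero) simp
  have F': "(?F has_derivative ?F') (at cp)"
    using real_inventory_has_derivative[OF cp_nonzero, of S "\<lambda>s. w s * of_int (s $ j)"]
    by (simp only: moment_def)
  obtain G where "GDERIV A cp :> G"
    using C1_at_germ[OF germ_cofactor[of j 1]] unfolding A_def by (auto elim: C1_atE)
  then have A': "(A has_derivative (\<lambda>v. v \<bullet> G)) (at cp)" by (simp add: gderiv_def)
  have "((\<lambda>x. ?F x / A x) has_derivative (\<lambda>v. (?F' v * A cp - ?F cp * (v \<bullet> G)) / (A cp * A cp))) (at cp)"
    by (rule has_derivative_divide'[OF F' A' A0(2)])
  then have quot: "((\<lambda>x. ?F x / A x) has_derivative (\<lambda>v. ?F' v / A cp)) (at cp)"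
    using A0(2) by (simp add: first_moment_zero)
  have "((\<lambda>x. x - (?F x / A x) *\<^sub>R axis j 1) has_derivative (\<lambda>v. v - (?F' v / A cp) *\<^sub>R axis j 1)) (at cp)"
    by (intro has_derivative_diff has_derivative_ident has_derivative_scaleR_left quot)
  moreover have "eventually (\<lambda>x. x - (?F x / A x) *\<^sub>R axis j 1 = real_phi j x) (nhds cp)"
    using eventually_positive
  proof eventually_elim
    case (elim x)
    then have "x $ j \<noteq> 0" "A x \<noteq> 0"
      using cofactor_pos[of x 1 j] unfolding A_def by (metis less_irrefl)+
    then have "x $ j - ?F x / A x = inverse (x $ j) * (cofactor j (-1) x / A x)"
      by (simp add: first_moment_decomp A_def diff_divide_distrib)
    then show ?case by (simp add: vec_eq_iff axis_def real_phi_def A_def)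
  qed
  ultimately have "(real_phi j has_derivative (\<lambda>v. v - (?F' v / A cp) *\<^sub>R axis j 1)) (at cp)"
    by (rule has_derivative_cong_nhds)
  moreover have "?F' v / A cp = 2 * cp $ j / moment j j * (\<Sum>k\<in>UNIV. moment j k * v $ k / cp $ k)" for v
    by (simp add: A0)
  ultimately show ?thesis by simp
qed

text \<open>Since \<open>hess_jk = m_jk / (x_j x_k)\<close>, the coefficient of \<open>e_j\<close>
  is \<open>2 h(e_j, v) / h(e_j, e_j)\<close> for the Hessian form \<open>h\<close>.\<close>

lemma rf_deriv_phi:
  "rf_deriv cp (phi S w j) =
    (\<lambda>v. v - (2 * cp $ j / moment j j * (\<Sum>k\<in>UNIV. moment j k * v $ k / cp $ k)) *\<^sub>R axis j 1)"
  by (rule rf_deriv_eqI[of _ _ "real_phi j"]) (rule germ_phi real_phi_cp real_phi_has_derivative)+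

section \<open>Euclidean coordinates on the tangent space\<close>

definition "sqrt_Delta = matrix_sqrt (Delta S w)"

lemma sqrt_Delta: "pos_def_matrix sqrt_Delta" "sqrt_Delta ** sqrt_Delta = Delta S w"
  using matrix_sqrt[OF pos_def_Delta] by (simp_all add: sqrt_Delta_def)

lemmas sqrt_Delta_inverse = matrix_inv_cancel[OF pos_def_invertible[OF sqrt_Delta(1)]]

text \<open>An isometry from the Hessian form to the Euclidean inner product: the scaling factor of
  coordinate \<open>k\<close> is the square root of \<open>hess_kk\<close>, which turns the Hessian
  matrix into \<open>Delta\<close>.\<close>

definition to_euclid :: "real ^ 'n::{finite,linorder} \<Rightarrow> real ^ 'n::{finite,linorder}" where
  "to_euclid v = sqrt_Delta *v (\<chi> k. sqrt (moment k k) * v $ k / cp $ k)"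

definition from_euclid :: "real ^ 'n::{finite,linorder} \<Rightarrow> real ^ 'n::{finite,linorder}" where
  "from_euclid z = (\<chi> k. cp $ k * (matrix_inv sqrt_Delta *v z) $ k / sqrt (moment k k))"

lemma sqrt_moment_nonzero: "sqrt (moment k k) \<noteq> 0"
  using moment_diag_pos[of k] by simp

lemma to_from_euclid: "to_euclid (from_euclid z) = z"
  using sqrt_moment_nonzero cp_nonzero by (simp add: to_euclid_def from_euclid_def sqrt_Delta_inverse)

lemma from_to_euclid: "from_euclid (to_euclid v) = v"
  using sqrt_moment_nonzero cp_nonzero by (simp add: to_euclid_def from_euclid_def sqrt_Delta_inverse vec_eq_iff)

lemma linear_to_euclid: "linear to_euclid"
proof -
  have "linear (\<lambda>v :: real ^ 'n::{finite,linorder}. \<chi> k. sqrt (moment k k) * v $ k / cp $ k)"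
    by (intro linearI) (simp_all add: vec_eq_iff field_simps add_divide_distrib)
  from linear_compose[OF this matrix_vector_mul_linear[of sqrt_Delta]] show ?thesis
    by (simp add: to_euclid_def[abs_def] o_def)
qed

definition tangent_rep :: "('n \<Rightarrow> 'n ratfun) \<Rightarrow> real ^ 'n::{finite,linorder} \<Rightarrow> real ^ 'n::{finite,linorder}" where
  "tangent_rep g = to_euclid \<circ> rf_deriv cp g \<circ> from_euclid"

lemma tangent_rep_rat_comp:
  "fixes_germ cp f \<Longrightarrow> fixes_germ cp g \<Longrightarrow> tangent_rep (rat_comp f g) = tangent_rep f \<circ> tangent_rep g"
  by (simp add: tangent_rep_def rf_deriv_rat_comp fun_eq_iff from_to_euclid)

lemma tangent_rep_var: "tangent_rep var_rf = id"
  by (simp add: tangent_rep_def rf_deriv_var fun_eq_iff to_from_euclid)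

lemma tangent_rep_eq_id: "tangent_rep g = id \<Longrightarrow> rf_deriv cp g = id"
  unfolding tangent_rep_def fun_eq_iff by (metis comp_apply id_apply from_to_euclid)

text \<open>The vector \<open>n\<close> is the normal of the wall, of length 1 because
  \<open>Delta\<close> has unit diagonal, and \<open>to_euclid\<close> sends \<open>e_j\<close> to a
  multiple of it. It remains to compare the scalar coefficients.\<close>

lemma tangent_rep_phi: "tangent_rep (phi S w j) = orth_reflection (wall S w j)"
proof -
  define n where "n = sqrt_Delta *v axis j 1"
  have n: "n \<bullet> z = (sqrt_Delta *v z) $ j" for z
    using sqrt_Delta(1) by (simp add: n_def pos_def_matrix_def matrix_vector_mult_self_adjoint inner_axis')
  have "n \<bullet> n = (Delta S w *v axis j 1) $ j"
    unfolding n by (simp add: n_def matrix_vector_mul_assoc sqrt_Delta(2))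
  then have nn: "n \<bullet> n = 1" by (simp add: matrix_vector_mult_basis column_def Delta_diag)
  have wall: "wall S w j = {x. n \<bullet> x = 0}"
    unfolding wall_def sqrt_Delta_def[symmetric] n_def by (rule image_matrix_inv_coordinate_hyperplane[OF sqrt_Delta(1)])
  have "tangent_rep (phi S w j) z = z - (2 * (n \<bullet> z)) *\<^sub>R n" for z
  proof -
    define c where "c = 2 * cp $ j / moment j j * (\<Sum>k\<in>UNIV. moment j k * from_euclid z $ k / cp $ k)"
    have "moment j k * from_euclid z $ k / cp $ k = sqrt (moment j j) * (Delta S w $ j $ k * (matrix_inv sqrt_Delta *v z) $ k)" for k
      using sqrt_moment_nonzero[of k] sqrt_moment_nonzero[of j] cp_nonzero[of k]
      by (simp add: from_euclid_def Delta_eq)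
    then have "c = 2 * cp $ j / moment j j * (sqrt (moment j j) * (Delta S w *v (matrix_inv sqrt_Delta *v z)) $ j)"
      by (simp add: c_def matrix_vector_mult_def sum_distrib_left)
    also have "Delta S w *v (matrix_inv sqrt_Delta *v z) = sqrt_Delta *v z"
      by (simp add: sqrt_Delta(2)[symmetric] sqrt_Delta_inverse flip: matrix_vector_mul_assoc)
    finally have c: "c = 2 * cp $ j / moment j j * (sqrt (moment j j) * (n \<bullet> z))" by (simp only: n)
    \<comment> \<open>Used with \<open>p\<close> the coordinate of \<open>cp\<close> and
      \<open>q\<close> the root of \<open>m = m_jj\<close>; the scalings cancel and leave the factor
      2.\<close>
    have "2 * p / m * (q * r) * (q / p) = 2 * r" if "p \<noteq> 0" "q \<noteq> 0" "m = q * q" for p q m r :: real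
      using that by (simp add: field_simps)
    from this[OF cp_nonzero[of j] sqrt_moment_nonzero[of j], of "moment j j" "n \<bullet> z"]
    have "c * (sqrt (moment j j) / cp $ j) = 2 * (n \<bullet> z)"
      unfolding c using moment_diag_pos[of j] by simp
    moreover have "to_euclid (axis j 1) = (sqrt (moment j j) / cp $ j) *\<^sub>R n"
    proof -
      have "(\<chi> k. sqrt (moment k k) * axis j 1 $ k / cp $ k) = (sqrt (moment j j) / cp $ j) *\<^sub>R axis j 1"
        by (simp add: vec_eq_iff axis_def)
      then show ?thesis by (simp add: to_euclid_def n_def matrix_vector_mult_scaleR)
    qed
    moreover have "tangent_rep (phi S w j) z = to_euclid (from_euclid z - c *\<^sub>R axis j 1)"
      by (simp add: tangent_rep_def rf_deriv_phi c_def)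
    ultimately show ?thesis
      by (simp add: linear_diff[OF linear_to_euclid] linear_scale[OF linear_to_euclid] to_from_euclid)
  qed
  then show ?thesis by (simp add: wall orth_reflection_hyperplane[OF nn] fun_eq_iff)
qed

lemma group_comb_group: "Group.group (comb_group S w)"
  unfolding comb_group_def by (rule group.group_subgroup_generated[OF group_birational_group])

lemma comb_group_simps: "mult (comb_group S w) = rat_comp" "\<one>\<^bsub>comb_group S w\<^esub> = var_rf"
  by (simp_all add: comb_group_def birational_group_def)

text \<open>Bijectivity of a derivative comes from the group: the image of the inverse element is a
  two-sided inverse map.\<close>

lemma tangent_rep_hom: "group_hom (comb_group S w) (BijGroup UNIV) tangent_rep"
proof -
  interpret G: group "comb_group S w" by (rule group_comb_group)
  have mult: "tangent_rep (f \<otimes>\<^bsub>comb_group S w\<^esub> g) = tangent_rep f \<circ> tangent_rep g"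
    if "f \<in> carrier (comb_group S w)" "g \<in> carrier (comb_group S w)" for f g
    using that fixes_germ_comb_group by (simp add: comb_group_simps tangent_rep_rat_comp)
  have bij: "tangent_rep g \<in> carrier (BijGroup UNIV)" if g: "g \<in> carrier (comb_group S w)" for g
  proof -
    let ?h = "inv\<^bsub>comb_group S w\<^esub> g"
    have "tangent_rep g \<circ> tangent_rep ?h = id" "tangent_rep ?h \<circ> tangent_rep g = id"
      using mult[of g ?h] mult[of ?h g] g by (simp_all add: comb_group_simps(2) tangent_rep_var)
    then have "bij (tangent_rep g)" using o_bij by blast
    then show ?thesis by (simp add: BijGroup_def Bij_def)
  qed
  have "tangent_rep \<in> hom (comb_group S w) (BijGroup UNIV)"
    by (rule homI) (simp_all add: bij mult mult_BijGroup_UNIV)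
  then show ?thesis
    using group_comb_group group_BijGroup by (simp add: group_hom_def group_hom_axioms_def)
qed

lemma tangent_rep_kernel:
  assumes fin: "finite (carrier (comb_group S w))"
    and g: "g \<in> carrier (comb_group S w)" "tangent_rep g = id"
  shows "g = var_rf"
proof -
  interpret G: group "comb_group S w" by (rule group_comb_group)
  let ?h = "\<lambda>m::nat. g [^]\<^bsub>comb_group S w\<^esub> m"
  show ?thesis
  proof (rule finite_order_tangent_identity[where a=cp and h="?h" and N="order (comb_group S w)"])
    show "?h (order (comb_group S w)) = var_rf"
      using G.pow_order_eq_1[OF g(1)] by (simp add: comb_group_simps)
    \<comment> \<open>The exponent is the group order. Since \<open>order\<close> is 0 for an
      infinite carrier, finiteness enters exactly here.\<close>
    show "order (comb_group S w) > 0"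
      using fin G.order_gt_0_iff_finite by simp
  qed (use g in \<open>simp_all add: cp_nonzero fixes_germ_comb_group tangent_rep_eq_id comb_group_simps\<close>)
qed

lemma comb_group_iso_refl_group:
  assumes fin: "finite (carrier (comb_group S w))"
  shows "comb_group S w \<cong> refl_group S w"
proof -
  interpret h: group_hom "comb_group S w" "BijGroup UNIV" tangent_rep
    by (rule tangent_rep_hom)
  interpret B: group birational_group by (rule group_birational_group)
  have gens: "range (phi S w) \<subseteq> carrier (comb_group S w)"
    unfolding carrier_comb_group by (auto intro: generate.incl)
  \<comment> \<open>Images of generated subgroups are computed inside the domain of the
    homomorphism, so generation is first moved from \<open>birational_group\<close> to
    \<open>comb_group\<close>.\<close>
  have "generate (comb_group S w) (range (phi S w)) = carrier (comb_group S w)"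
    using B.subgroup_generated2[of "range (phi S w)"] gens
    by (metis carrier_subgroup_generated comb_group_def inf.absorb2)
  then have img: "tangent_rep ` carrier (comb_group S w) =
      generate (BijGroup UNIV) (range (\<lambda>i. orth_reflection (wall S w i)))"
    using h.generate_img[OF gens] by (simp add: image_image tangent_rep_phi)
  have "range (\<lambda>i. orth_reflection (wall S w i)) \<subseteq> carrier (BijGroup UNIV)"
    using gens h.hom_closed by (auto simp flip: tangent_rep_phi)
  then have carr: "carrier (refl_group S w) = tangent_rep ` carrier (comb_group S w)"
    unfolding img refl_group_def carrier_subgroup_generated by (simp add: Int_absorb1)
  have "inj_on tangent_rep (carrier (comb_group S w))"
    unfolding h.inj_on_one_iff
    using tangent_rep_kernel[OF fin] by (auto simp: comb_group_simps BijGroup_def id_def restrict_def)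
  moreover have "tangent_rep \<in> hom (comb_group S w) (refl_group S w)"
  proof (rule homI)
    show "tangent_rep (f \<otimes>\<^bsub>comb_group S w\<^esub> g) = tangent_rep f \<otimes>\<^bsub>refl_group S w\<^esub> tangent_rep g"
      if "f \<in> carrier (comb_group S w)" "g \<in> carrier (comb_group S w)" for f g
      using h.hom_mult[OF that] by (simp add: refl_group_def)
  qed (simp add: carr)
  ultimately have "tangent_rep \<in> iso (comb_group S w) (refl_group S w)"
    by (simp add: iso_def bij_betw_def carr)
  then show ?thesis by (auto simp: is_iso_def)
qed

end

theorem theorem2:
  fixes S :: "(int ^ 'n::{finite,linorder}) set"
    and w :: "int ^ 'n::{finite,linorder} \<Rightarrow> real"
  assumes "S \<subseteq> {s. \<forall>i. s $ i \<in> {-1, 0, 1}}"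
    and "\<And>s. s \<in> S \<Longrightarrow> w s > 0"
    and "\<nexists>u :: real ^ 'n::{finite,linorder}. u \<noteq> 0 \<and> step_vec ` S \<subseteq> {y. u \<bullet> y \<ge> 0}"
    and "finite (carrier (comb_group S w))"
  shows "comb_group S w \<cong> refl_group S w"
proof -
  interpret step_model S w by unfold_locales (use assms in auto)
  show ?thesis using assms(4) by (rule comb_group_iso_refl_group)
qed

end
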